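(* Let $\mathcal{P}=\mathcal{I}\cup\mathcal{R}_1\cup\dots\cup\mathcal{R}_r$ be a polyomino, where $\mathcal{I}$ is a parallelogram polyomino and $\mathcal{R}_1,\dots,\mathcal{R}_r$ are ladder sub-polyominoes of $\mathcal{P}$, each based on $\mathcal{I}$, such that $V(\mathcal{R}_i)\cap V(\mathcal{R}_j)=\varnothing$ for $i\neq j$. Let $K$ be a field, $S=K[x_a\mid a\in V(\mathcal{P})]$, and let $f=\prod_{k=1}^s f_k\in S$ be the product of determinants attached to $\mathcal{P}$, and $g=\prod_{k:\,|V_k|\ge 2} f_k$ (both defined in the context). Then $I_{\mathcal{P}}\in\mathcal{C}_f$. In fact $I_{\mathcal{P}}\in\mathcal{C}_g$.
   Context: $\mathbb{N}$ is the set of nonnegative integers, and $(i,j)\le (k,l)$ in $\mathbb{N}^2$ means $i\le k$ and $j\le l$. For $a=(i,j)\le b=(k,l)$ put $[a,b]=\{m\in\mathbb{N}^2: a\le m\le b\}$; it is a proper interval if $i<k$ and $j<l$. The diagonal vertices of a proper interval are $a$ (lower-left) and $b$ (upper-right), and its anti-diagonal vertices are $(i,l)$ (upper-left) and $(k,j)$ (lower-right). A cell is $C=[a,a+(1,1)]$; $V(C)$ is the set of its four vertices and its edges are the four pairs of adjacent vertices. For a finite collection of cells $\mathcal{P}$, $V(\mathcal{P})=\bigcup_{C\in\mathcal{P}}V(C)$. A polyomino is a non-empty finite collection of cells in $(\mathbb{N}\setminus\{0\})^2$ such that any two of its cells $C,D$ are joined by a sequence of cells $C=C_1,\dots,C_m=D$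 of the collection with $C_i\cap C_{i+1}$ an edge of both for all $i$. A sub-polyomino of $\mathcal{P}$ is a polyomino all of whose cells are in $\mathcal{P}$. A polyomino is horizontally convex if whenever two of its cells have lower-left vertices $(i,j)$ and $(k,j)$ with $k>i$, every cell with lower-left vertex $(l,j)$, $i\le l\le k$, belongs to it; vertically convex is defined analogously; convex means both. A parallelogram polyomino is a convex polyomino whose vertex set is a sub-lattice of $\mathbb{N}^2$. For a horizontally convex polyomino $\mathcal{R}$, the set of left-most vertices is the set $\{a_1=(a_{1,1},a_{1,2}),\dots,a_t=(a_{t,1},a_{t,2})\}\subset V(\mathcal{R})$, $a_{1,2}<\dots<a_{t,2}$, such that every $v=(v_1,v_2)\in V(\mathcal{R})$ is either some $a_i$, or there is $j$ with $v_2=a_{j,2}$ and $a_{j,1}<v_1$. $\mathcal{R}$ is a ladder polyomino if for each $2\le i\le t$, $a_i$ is the upper-left vertex of a cell in $\mathcal{R}$. Based on: for a cell $C=[a,a+(1,1)]$ let $\operatorname{sp}(C)=\{x\in\mathbb{R}^2: a\le x\le a+(1,1)\}$, and for a collection of cells $\operatorname{sp}(\mathcal{P})=\bigcup_{C\in\mathcal{P}}\operatorname{sp}(C)$. Let $\mathcal{R}$ be a ladder polyomino with set of left-most vertices $\{a_1=(a_{1,1},a_{1,2}),\dots,a_t=(a_{t,1},a_{t,2})\}$, indexed so that $a_{1,2}<\dots<a_{t,2}$, and $b=\max\{v\in\mathbb{N}: (v,a_{1,2})\in V(\mathcal{R})\}$. $\mathcal{R}$ is based on a polyomino $\mathcal{Q}$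 if $\operatorname{sp}(\mathcal{R})\cap\operatorname{sp}(\mathcal{Q})$ equals the closed real segment $[a_1,(b,a_{1,2})]$ (so $\mathcal{R}$ sits on top of $\mathcal{Q}$ along its bottom edge). An inner interval of $\mathcal{P}$ is a proper interval $[a,b]$ with $a,b\in V(\mathcal{P})$ all of whose cells belong to $\mathcal{P}$. $I_{\mathcal{P}}\subset S$ is the ideal generated by all binomials $x_ax_b-x_cx_d$, where $[a,b]$ ranges over the inner intervals of $\mathcal{P}$ and $c,d$ are its anti-diagonal vertices. The polynomials $f_k$: partition $V(\mathcal{P})$ into sets $V_1,\dots,V_s$, $V_k=\{v_{k,1},\dots,v_{k,n_k}\}$, such that: (i) for $1\le i<n_k$, $v_{k,i}$ and $v_{k,i+1}$ are respectively the upper-left and lower-right vertices of a cell of $\mathcal{P}$; (ii) $v_{k,1}$ is not a lower-right vertex, and $v_{k,n_k}$ is not an upper-left vertex, of any cell of $\mathcal{P}$; (iii) for $k<l$, with $v_{k,1}=(v_1,v_2)$ and $v_{l,1}=(w_1,w_2)$, either $v_1+v_2<w_1+w_2$, or $v_1+v_2=w_1+w_2$ and $v_1<w_1$. Write $v_{k,1}=(i_k+1,j_k+n_k)$, so $v_{k,l}=(i_k+l,j_k+n_k+1-l)$. Let $M_k$ be the $n_k\times n_k$ matrix whose $(a,b)$ entry is $x_{i_k+a,\,j_k+b}$ if $(i_k+a,j_k+b)\in V(\mathcal{P})$ and $0$ otherwise, and let $f_k=\det M_k$. Monomial order: order the variables by $x_{i,j}<x_{k,l}$ if $i<k$, or $i=k$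 and $j<l$, and let $<$ be the induced graded reverse lexicographic order on $S$; $\operatorname{in}_<(f)$ and $\operatorname{in}_<(g)$ are square-free. $\mathcal{C}_f$: for $f\in S$ with $\operatorname{in}_<(f)$ a square-free monomial for some monomial order, $\mathcal{C}_f$ is the smallest set of ideals of $S$ such that: (1) $(f)\in\mathcal{C}_f$; (2) if $I\in\mathcal{C}_f$ and $J$ is any ideal of $S$, then $I:J\in\mathcal{C}_f$; (3) if $I,J\in\mathcal{C}_f$, then $I+J,\ I\cap J\in\mathcal{C}_f$. *)

theory Defs
  imports
    "HOL-Library.Poly_Mapping"
    "HOL-Algebra.Ideal"
    "HOL-Analysis.Line_Segment"
    "Jordan_Normal_Form.Determinant"
begin

section \<open>Collections of cells\<close>

type_synonym vertex = "nat \<times> nat"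

text \<open>
  A cell \<open>[a, a + (1,1)]\<close> is encoded by its lower-left vertex \<open>a\<close>, and a collection of cells
  by the set of these lower-left vertices.
\<close>

type_synonym cells = "vertex set"

definition interval :: "vertex \<Rightarrow> vertex \<Rightarrow> vertex set" where
  "interval a b = {fst a..fst b} \<times> {snd a..snd b}"

definition proper_interval :: "vertex \<Rightarrow> vertex \<Rightarrow> bool" where
  "proper_interval a b \<longleftrightarrow> fst a < fst b \<and> snd a < snd b"

definition upper_left :: "vertex \<Rightarrow> vertex" where
  "upper_left c = (fst c, snd c + 1)"

definition lower_right :: "vertex \<Rightarrow> vertex" where
  "lower_right c = (fst c + 1, snd c)"

definition upper_right :: "vertex \<Rightarrow> vertex" where
  "upper_right c = (fst c + 1, snd c + 1)"

definition cell :: "vertex \<Rightarrow> vertex set" where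
  "cell c = interval c (upper_right c)"

text \<open>A cell is a subset of \<open>\<nat>\<^sup>2\<close> and so equals the set \<open>V(C)\<close> of its four vertices.\<close>

definition cell_edges :: "vertex \<Rightarrow> vertex set set" where
  "cell_edges c =
     {{c, lower_right c}, {c, upper_left c},
      {lower_right c, upper_right c}, {upper_left c, upper_right c}}"

definition vertices :: "cells \<Rightarrow> vertex set" where
  "vertices P = (\<Union>c\<in>P. cell c)"

definition edge_adjacent :: "vertex \<Rightarrow> vertex \<Rightarrow> bool" where
  "edge_adjacent c d \<longleftrightarrow> cell c \<inter> cell d \<in> cell_edges c \<inter> cell_edges d"

definition polyomino :: "cells \<Rightarrow> bool" where
  "polyomino P \<longleftrightarrow>
     P \<noteq> {} \<and> finite P \<and> (\<forall>c\<in>P. cell c \<subseteq> {1..} \<times> {1..}) \<and>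
     (\<forall>c\<in>P. \<forall>d\<in>P. \<exists>cs. cs \<noteq> [] \<and> hd cs = c \<and> last cs = d \<and> set cs \<subseteq> P \<and>
        (\<forall>i. Suc i < length cs \<longrightarrow> edge_adjacent (cs ! i) (cs ! Suc i)))"

definition sub_polyomino :: "cells \<Rightarrow> cells \<Rightarrow> bool" where
  "sub_polyomino R P \<longleftrightarrow> polyomino R \<and> R \<subseteq> P"

definition horizontally_convex :: "cells \<Rightarrow> bool" where
  "horizontally_convex P \<longleftrightarrow>
     (\<forall>i k j. (i, j) \<in> P \<and> (k, j) \<in> P \<and> i < k \<longrightarrow> (\<forall>l\<in>{i..k}. (l, j) \<in> P))"

definition vertically_convex :: "cells \<Rightarrow> bool" where
  "vertically_convex P \<longleftrightarrow>
     (\<forall>i j k. (i, j) \<in> P \<and> (i, k) \<in> P \<and> j < k \<longrightarrow> (\<forall>l\<in>{j..k}. (i, l) \<in> P))"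

text \<open>Meet and join in \<open>\<nat>\<^sup>2\<close> are the componentwise minimum and maximum.\<close>

definition sublattice :: "vertex set \<Rightarrow> bool" where
  "sublattice A \<longleftrightarrow>
     (\<forall>a\<in>A. \<forall>b\<in>A. (min (fst a) (fst b), min (snd a) (snd b)) \<in> A \<and>
                     (max (fst a) (fst b), max (snd a) (snd b)) \<in> A)"

definition parallelogram_polyomino :: "cells \<Rightarrow> bool" where
  "parallelogram_polyomino P \<longleftrightarrow>
     polyomino P \<and> horizontally_convex P \<and> vertically_convex P \<and> sublattice (vertices P)"

text \<open>
  \<open>leftmost_list R as\<close>: the list \<open>as = [a\<^sub>1, \<dots>, a\<^sub>t]\<close> enumerates the left-most vertices of \<open>R\<close>
  by increasing second coordinate.
\<close>

definition leftmost_list :: "cells \<Rightarrow> vertex list \<Rightarrow> bool" where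
  "leftmost_list R as \<longleftrightarrow>
     set as \<subseteq> vertices R \<and> sorted_wrt (\<lambda>a a'. snd a < snd a') as \<and>
     (\<forall>v\<in>vertices R. v \<in> set as \<or> (\<exists>a\<in>set as. snd v = snd a \<and> fst a < fst v))"

definition ladder_polyomino :: "cells \<Rightarrow> bool" where
  "ladder_polyomino R \<longleftrightarrow>
     polyomino R \<and> horizontally_convex R \<and>
     (\<exists>as. leftmost_list R as \<and>
        (\<forall>i. 1 \<le> i \<and> i < length as \<longrightarrow> (\<exists>c\<in>R. as ! i = upper_left c)))"

definition cell_support :: "vertex \<Rightarrow> (real \<times> real) set" where
  "cell_support c = {real (fst c)..real (fst c) + 1} \<times> {real (snd c)..real (snd c) + 1}"

definition support :: "cells \<Rightarrow> (real \<times> real) set" where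
  "support P = (\<Union>c\<in>P. cell_support c)"

definition based_on :: "cells \<Rightarrow> cells \<Rightarrow> bool" where
  "based_on R Q \<longleftrightarrow>
     (\<exists>as. leftmost_list R as \<and>
        (let a = hd as; b = Max {v. (v, snd a) \<in> vertices R}
         in support R \<inter> support Q =
              closed_segment (real (fst a), real (snd a)) (real b, real (snd a))))"


section \<open>Polynomials and the polyomino ideal\<close>

text \<open>Polynomials with coefficients in \<open>'k\<close> in the indeterminates \<open>x\<^sub>v\<close>, one for every vertex \<open>v\<close>.\<close>

type_synonym monomial = "vertex \<Rightarrow>\<^sub>0 nat"
type_synonym 'k polynomial = "monomial \<Rightarrow>\<^sub>0 'k"

definition indet :: "vertex \<Rightarrow> 'k::field polynomial" where
  "indet v = Poly_Mapping.single (Poly_Mapping.single v 1) 1"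

text \<open>The subring \<open>K[x\<^sub>v | v \<in> V]\<close>.\<close>

definition poly_ring :: "vertex set \<Rightarrow> 'k::field polynomial ring" where
  "poly_ring V =
     \<lparr>carrier = {p. \<forall>m\<in>Poly_Mapping.keys p. Poly_Mapping.keys m \<subseteq> V},
      monoid.mult = (*), one = 1, zero = 0, add = (+)\<rparr>"

definition inner_interval :: "cells \<Rightarrow> vertex \<Rightarrow> vertex \<Rightarrow> bool" where
  "inner_interval P a b \<longleftrightarrow>
     proper_interval a b \<and> a \<in> vertices P \<and> b \<in> vertices P \<and>
     (\<forall>c. cell c \<subseteq> interval a b \<longrightarrow> c \<in> P)"

definition polyomino_ideal :: "cells \<Rightarrow> 'k::field polynomial set" where
  "polyomino_ideal P =
     Idl\<^bsub>poly_ring (vertices P)\<^esub>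
       {indet a * indet b - indet (fst a, snd b) * indet (fst b, snd a) | a b. inner_interval P a b}"


section \<open>The determinants attached to a collection of cells\<close>

text \<open>
  \<open>Vs = [V\<^sub>1, \<dots>, V\<^sub>s]\<close> is the ordered partition of the vertex set into anti-diagonal chains
  \<open>V\<^sub>k = [v\<^sub>k\<^sub>,\<^sub>1, \<dots>, v\<^sub>k\<^sub>,\<^sub>n]\<close>.
\<close>

definition antidiagonal_partition :: "cells \<Rightarrow> vertex list list \<Rightarrow> bool" where
  "antidiagonal_partition P Vs \<longleftrightarrow>
     [] \<notin> set Vs \<and> distinct (concat Vs) \<and> set (concat Vs) = vertices P \<and>
     (\<forall>vs\<in>set Vs. \<forall>i. Suc i < length vs \<longrightarrow>
        (\<exists>c\<in>P. vs ! i = upper_left c \<and> vs ! Suc i = lower_right c)) \<and>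
     (\<forall>vs\<in>set Vs. \<forall>c\<in>P. hd vs \<noteq> lower_right c \<and> last vs \<noteq> upper_left c) \<and>
     sorted_wrt (\<lambda>vs ws.
        fst (hd vs) + snd (hd vs) < fst (hd ws) + snd (hd ws) \<or>
        fst (hd vs) + snd (hd vs) = fst (hd ws) + snd (hd ws) \<and> fst (hd vs) < fst (hd ws)) Vs"

text \<open>
  Writing \<open>v\<^sub>k\<^sub>,\<^sub>1 = (i\<^sub>k + 1, j\<^sub>k + n\<^sub>k)\<close>, the last vertex of the chain is \<open>(i\<^sub>k + n\<^sub>k, j\<^sub>k + 1)\<close>.  As matrices
  are indexed from 0, the entry in position \<open>(a, b)\<close> belongs to the vertex
  \<open>(i\<^sub>k + 1 + a, j\<^sub>k + 1 + b)\<close>.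
\<close>

definition chain_matrix :: "cells \<Rightarrow> vertex list \<Rightarrow> 'k::field polynomial mat" where
  "chain_matrix P vs =
     mat (length vs) (length vs)
       (\<lambda>(a, b). let v = (fst (hd vs) + a, snd (last vs) + b)
                 in if v \<in> vertices P then indet v else 0)"

definition chain_det :: "cells \<Rightarrow> vertex list \<Rightarrow> 'k::field polynomial" where
  "chain_det P vs = Determinant.det (chain_matrix P vs)"


section \<open>Monomial orders and Knutson ideals\<close>

definition monomials :: "vertex set \<Rightarrow> monomial set" where
  "monomials V = {m. Poly_Mapping.keys m \<subseteq> V}"

text \<open>A pair \<open>(m, n) \<in> r\<close> means \<open>m \<le> n\<close>.\<close>

definition monomial_order :: "vertex set \<Rightarrow> monomial rel \<Rightarrow> bool" where
  "monomial_order V r \<longleftrightarrow>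
     linear_order_on (monomials V) r \<and> (\<forall>m\<in>monomials V. (0, m) \<in> r) \<and>
     (\<forall>m n. (m, n) \<in> r \<longrightarrow> (\<forall>l\<in>monomials V. (m + l, n + l) \<in> r))"

definition initial_monomial :: "monomial rel \<Rightarrow> 'k::field polynomial \<Rightarrow> monomial \<Rightarrow> bool" where
  "initial_monomial r f m \<longleftrightarrow>
     m \<in> Poly_Mapping.keys f \<and> (\<forall>n\<in>Poly_Mapping.keys f. (n, m) \<in> r)"

definition squarefree_monomial :: "monomial \<Rightarrow> bool" where
  "squarefree_monomial m \<longleftrightarrow> (\<forall>v. Poly_Mapping.lookup m v \<le> 1)"

definition has_squarefree_initial :: "vertex set \<Rightarrow> 'k::field polynomial \<Rightarrow> bool" where
  "has_squarefree_initial V f \<longleftrightarrow>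
     (\<exists>r m. monomial_order V r \<and> initial_monomial r f m \<and> squarefree_monomial m)"

definition colon :: "('a, 'b) ring_scheme \<Rightarrow> 'a set \<Rightarrow> 'a set \<Rightarrow> 'a set" where
  "colon S I J = {x \<in> carrier S. \<forall>y\<in>J. x \<otimes>\<^bsub>S\<^esub> y \<in> I}"

text \<open>
  The set \<open>C\<^sub>f\<close> is only defined if \<open>f\<close> lies in \<open>K[x\<^sub>v | v \<in> V]\<close> and has a square-free initial
  monomial for some monomial order.  This is a side condition of the rule for the principal ideal
  \<open>(f)\<close>, so that the set is empty for all other \<open>f\<close>.
\<close>

inductive_set knutson_ideals :: "vertex set \<Rightarrow> 'k::field polynomial \<Rightarrow> 'k polynomial set set"
  for V f where
  principal:
    "f \<in> carrier (poly_ring V) \<Longrightarrow> has_squarefree_initial V f \<Longrightarrow>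
       Idl\<^bsub>poly_ring V\<^esub> {f} \<in> knutson_ideals V f"
| colon:
    "I \<in> knutson_ideals V f \<Longrightarrow> ideal J (poly_ring V) \<Longrightarrow>
       colon (poly_ring V) I J \<in> knutson_ideals V f"
| sum:
    "I \<in> knutson_ideals V f \<Longrightarrow> J \<in> knutson_ideals V f \<Longrightarrow>
       I <+>\<^bsub>poly_ring V\<^esub> J \<in> knutson_ideals V f"
| inter:
    "I \<in> knutson_ideals V f \<Longrightarrow> J \<in> knutson_ideals V f \<Longrightarrow> I \<inter> J \<in> knutson_ideals V f"

end

theory Submission
  imports Defs "HOL-Library.Product_Lexorder"
begin

text \<open>
  The only property of the shape of \<open>P\<close> that is needed is corner closedness: if the cells
  \<open>(x, y + 1)\<close> and \<open>(x + 1, y)\<close> belong to \<open>P\<close>, so does \<open>(x, y)\<close>.  Then no matrix \<open>M\<^sub>k\<close> has a zero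
  on or below its antidiagonal.  Let \<open>T(D)\<close> be the lattice ideal of a set \<open>D\<close> of cells; it is
  prime, contains no variable, and contains the minor \<open>m(c)\<close> of a cell \<open>c\<close> iff \<open>c \<in> D\<close>.  Row
  operations show that, up to monomial factors, \<open>f\<^sub>k\<close> is the product of the \<open>m(c)\<close> over the cells
  \<open>c\<close> of the chain \<open>V\<^sub>k\<close>, modulo the minors of the cells below the chain.  Suppose that \<open>D\<close>
  contains all cells below the chain and none of the chain, and that a Knutson ideal \<open>L \<subseteq> T(D)\<close>
  contains monomial multiples of all \<open>m(d)\<close>, \<open>d \<in> D\<close>.  For a cell \<open>c\<close> of the chain, let \<open>h\<close> be a
  suitable monomial times the product of \<open>m(c')\<close> over the other cells \<open>c'\<close> of the chain.  Then
  \<open>(L + (f\<^sub>k)) : (h)\<close> contains \<open>m(c)\<close> and lies in \<open>T(D \<union> {c})\<close>.  Adding up these ideals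
  antidiagonal by antidiagonal one reaches \<open>D = P\<close>, and a last colon by a monomial gives \<open>T(P)\<close>,
  which equals \<open>I\<^sub>P\<close> by induction on the cells of \<open>P\<close>.
\<close>

section \<open>Ideals of the polynomial ring and monomial saturation\<close>

abbreviation "keys \<equiv> Poly_Mapping.keys"
abbreviation "lookup \<equiv> Poly_Mapping.lookup"
abbreviation "single \<equiv> Poly_Mapping.single"

section \<open>Membership and closure properties of the subring of polynomials in the variables of
  \<open>V\<close>\<close>

lemma in_poly_ring_iff: "p \<in> carrier (poly_ring V) \<longleftrightarrow> (\<forall>m\<in>keys p. keys m \<subseteq> V)"
  by (simp add: poly_ring_def)

lemma poly_ring_ops [simp]:
  "\<zero>\<^bsub>poly_ring V\<^esub> = 0" "\<one>\<^bsub>poly_ring V\<^esub> = 1"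
  "x \<oplus>\<^bsub>poly_ring V\<^esub> y = x + y" "x \<otimes>\<^bsub>poly_ring V\<^esub> y = x * y"
  by (simp_all add: poly_ring_def)

lemma poly_ring_zero [simp]: "0 \<in> carrier (poly_ring V)"
  by (simp add: in_poly_ring_iff)

lemma poly_ring_one [simp]: "1 \<in> carrier (poly_ring V)"
  by (simp add: in_poly_ring_iff)

lemma poly_ring_add [simp]:
  "p \<in> carrier (poly_ring V) \<Longrightarrow> q \<in> carrier (poly_ring V) \<Longrightarrow> p + q \<in> carrier (poly_ring V)"
  unfolding in_poly_ring_iff using Poly_Mapping.keys_add[of p q] by blast

lemma poly_ring_uminus [simp]:
  "p \<in> carrier (poly_ring V) \<Longrightarrow> - p \<in> carrier (poly_ring V)"
  unfolding in_poly_ring_iff by (simp add: in_keys_iff)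

lemma poly_ring_diff [simp]:
  "p \<in> carrier (poly_ring V) \<Longrightarrow> q \<in> carrier (poly_ring V) \<Longrightarrow> p - q \<in> carrier (poly_ring V)"
  using poly_ring_add[of p V "- q"] by simp

lemma poly_ring_mult [simp]:
  assumes "p \<in> carrier (poly_ring V)" "q \<in> carrier (poly_ring V)"
  shows "p * q \<in> carrier (poly_ring V)"
  unfolding in_poly_ring_iff
proof
  fix m assume "m \<in> keys (p * q)"
  then obtain a b where "m = a + b" "a \<in> keys p" "b \<in> keys q"
    using keys_mult by blast
  then show "keys m \<subseteq> V"
    using assms Poly_Mapping.keys_add[of a b] unfolding in_poly_ring_iff by blast
qed

lemma poly_ring_sum [simp]:
  "(\<And>a. a \<in> A \<Longrightarrow> f a \<in> carrier (poly_ring V)) \<Longrightarrow> sum f A \<in> carrier (poly_ring V)"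
  by (induction A rule: infinite_finite_induct) auto

lemma poly_ring_prod [simp]:
  "(\<And>a. a \<in> A \<Longrightarrow> f a \<in> carrier (poly_ring V)) \<Longrightarrow> prod f A \<in> carrier (poly_ring V)"
  by (induction A rule: infinite_finite_induct) auto

lemma poly_ring_power [simp]:
  "p \<in> carrier (poly_ring V) \<Longrightarrow> p ^ n \<in> carrier (poly_ring V)"
  by (induction n) auto

lemma poly_ring_indet [simp]: "v \<in> V \<Longrightarrow> indet v \<in> carrier (poly_ring V)"
  by (simp add: in_poly_ring_iff indet_def)

lemma poly_ring_single [simp]: "keys m \<subseteq> V \<Longrightarrow> single m c \<in> carrier (poly_ring V)"
  by (simp add: in_poly_ring_iff)

lemma cring_poly_ring: "cring (poly_ring V)"
proof (rule cringI)
  show "abelian_group (poly_ring V)"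
  proof (rule abelian_groupI)
    fix x assume x: "x \<in> carrier (poly_ring V)"
    show "\<exists>y\<in>carrier (poly_ring V). y \<oplus>\<^bsub>poly_ring V\<^esub> x = \<zero>\<^bsub>poly_ring V\<^esub>"
      by (rule bexI[of _ "- x"]) (use x in auto)
  qed (auto simp: algebra_simps)
  show "comm_monoid (poly_ring V)"
    by (rule comm_monoidI) (auto simp: algebra_simps)
qed (auto simp: algebra_simps)

lemma ring_poly_ring: "ring (poly_ring V)"
  using cring_poly_ring cring.axioms(1) by blast

lemma ideal_poly_ringD:
  assumes "ideal J (poly_ring V)"
  shows "J \<subseteq> carrier (poly_ring V)" "0 \<in> J"
    "\<And>x y. x \<in> J \<Longrightarrow> y \<in> J \<Longrightarrow> x + y \<in> J"
    "\<And>x y. x \<in> carrier (poly_ring V) \<Longrightarrow> y \<in> J \<Longrightarrow> x * y \<in> J"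
    "\<And>x y. x \<in> J \<Longrightarrow> y \<in> carrier (poly_ring V) \<Longrightarrow> x * y \<in> J"
    "\<And>x. x \<in> J \<Longrightarrow> - x \<in> J" "\<And>x y. x \<in> J \<Longrightarrow> y \<in> J \<Longrightarrow> x - y \<in> J"
proof -
  interpret ideal J "poly_ring V" by fact
  show *: "J \<subseteq> carrier (poly_ring V)" using a_subset .
  show "0 \<in> J" using additive_subgroup.zero_closed[OF is_additive_subgroup] by simp
  show add: "x + y \<in> J" if "x \<in> J" "y \<in> J" for x y
    using additive_subgroup.a_closed[OF is_additive_subgroup that] by simp
  show mult: "x * y \<in> J" if "x \<in> carrier (poly_ring V)" "y \<in> J" for x y
    using I_l_closed[OF that(2,1)] by simp
  show "x * y \<in> J" if "x \<in> J" "y \<in> carrier (poly_ring V)" for x y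
    using I_r_closed[OF that] by simp
  show um: "- x \<in> J" if "x \<in> J" for x
    using mult[of "- 1" x] that by simp
  show "x - y \<in> J" if "x \<in> J" "y \<in> J" for x y
    using add[OF that(1) um[OF that(2)]] by simp
qed

lemma ideal_poly_ringI:
  assumes "J \<subseteq> carrier (poly_ring V)" "0 \<in> J"
    and add: "\<And>x y. x \<in> J \<Longrightarrow> y \<in> J \<Longrightarrow> x + y \<in> J"
    and mult: "\<And>x y. x \<in> carrier (poly_ring V) \<Longrightarrow> y \<in> J \<Longrightarrow> x * y \<in> J"
  shows "ideal J (poly_ring V)"
proof -
  interpret ring "poly_ring V" by (rule ring_poly_ring)
  have um: "- x \<in> J" if "x \<in> J" for x
    using mult[of "- 1" x] that by simp
  show ?thesis
  proof (rule idealI[OF ring_poly_ring])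
    show "subgroup J (add_monoid (poly_ring V))"
    proof (rule group.subgroupI)
      show "group (add_monoid (poly_ring V))" by (rule a_group)
      fix a assume a: "a \<in> J"
      have "\<ominus>\<^bsub>poly_ring V\<^esub> a = - a"
        using assms(1) a by (intro minus_equality) auto
      then show "inv\<^bsub>add_monoid (poly_ring V)\<^esub> a \<in> J"
        using um[OF a] by (simp add: a_inv_def)
    qed (use assms in auto)
  next
    fix a x :: "'a polynomial" assume "a \<in> J" "x \<in> carrier (poly_ring V)"
    then show "x \<otimes>\<^bsub>poly_ring V\<^esub> a \<in> J" "a \<otimes>\<^bsub>poly_ring V\<^esub> x \<in> J"
      using mult[of x a] by (simp_all add: mult.commute)
  qed
qed

lemma ideal_sum:
  assumes "ideal J (poly_ring V)" "\<And>a. a \<in> A \<Longrightarrow> f a \<in> J"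
  shows "sum f A \<in> J"
  using assms(2) by (induction A rule: infinite_finite_induct)
    (auto intro: ideal_poly_ringD(2,3)[OF assms(1)])

section \<open>Ideals modulo which every variable is a non-zero-divisor, and saturation by the
  variables\<close>

definition saturated :: "vertex set \<Rightarrow> 'k::field polynomial set \<Rightarrow> bool" where
  "saturated V J \<longleftrightarrow> ideal J (poly_ring V) \<and>
     (\<forall>v\<in>V. \<forall>p\<in>carrier (poly_ring V). indet v * p \<in> J \<longrightarrow> p \<in> J)"

text \<open>With \<open>w\<close> the product of all variables and \<open>L\<close> an ideal, this
  is \<open>L : w^infinity\<close>.\<close>

definition saturation :: "vertex set \<Rightarrow> 'k::field polynomial set \<Rightarrow> 'k polynomial set" where
  "saturation V L = {p \<in> carrier (poly_ring V). \<exists>n. (\<Prod>v\<in>V. indet v) ^ n * p \<in> L}"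

text \<open>Exponents are added up along the finite set. A colon by one power of the product of the
  variables then captures finitely many generators at once.\<close>

lemma saturation_uniform_exponent:
  assumes L: "ideal L (poly_ring V)" and "finite A" "A \<subseteq> saturation V L"
  shows "\<exists>n. \<forall>p\<in>A. (\<Prod>v\<in>V. indet v) ^ n * p \<in> L"
  using assms(2,3)
proof (induction A)
  case (insert p A)
  let ?w = "\<Prod>v\<in>V. indet v :: 'a polynomial"
  have w: "?w ^ i \<in> carrier (poly_ring V)" for i by auto
  from insert obtain n where n: "\<forall>q\<in>A. ?w ^ n * q \<in> L" by auto
  from insert.prems obtain m where m: "?w ^ m * p \<in> L" by (auto simp: saturation_def)
  have "?w ^ (n + m) * q \<in> L" if "q \<in> insert p A" for q
  proof (cases "q = p")
    case True
    then show ?thesis using ideal_poly_ringD(4)[OF L w[of n] m] by (simp add: power_add mult.assoc)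
  next
    case False
    then have "?w ^ n * q \<in> L" using n that by simp
    from ideal_poly_ringD(4)[OF L w[of m] this] show ?thesis
      by (simp add: power_add mult_ac)
  qed
  then show ?case by blast
qed auto

lemma saturation_superset:
  assumes L: "ideal L (poly_ring V)" shows "L \<subseteq> saturation V L"
proof
  fix p assume p: "p \<in> L"
  then have "(\<Prod>v\<in>V. indet v) ^ 0 * p \<in> L" by simp
  then show "p \<in> saturation V L" unfolding saturation_def
    using p ideal_poly_ringD(1)[OF L] by blast
qed

lemma saturation_mono: "L \<subseteq> L' \<Longrightarrow> saturation V L \<subseteq> saturation V L'"
  unfolding saturation_def by blast

text \<open>If a power of the product brings \<open>x_v p\<close> into \<open>L\<close>, multiplying
  by the remaining variables completes one more copy of the product. Finiteness of \<open>V\<close>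
  matters, as an infinite product is 1.\<close>

lemma saturated_saturation:
  assumes L: "ideal L (poly_ring V)" and V: "finite V"
  shows "saturated V (saturation V L)"
  unfolding saturated_def
proof (intro conjI ballI impI)
  let ?w = "\<Prod>v\<in>V. indet v :: 'a polynomial"
  have w: "?w ^ i \<in> carrier (poly_ring V)" for i by auto
  show "ideal (saturation V L) (poly_ring V)"
  proof (rule ideal_poly_ringI)
    fix x y assume xy: "x \<in> saturation V L" "y \<in> saturation V L"
    then obtain n where "\<forall>p\<in>{x, y}. ?w ^ n * p \<in> L"
      using saturation_uniform_exponent[OF L, of "{x, y}"] by auto
    then have "?w ^ n * (x + y) \<in> L"
      using ideal_poly_ringD(3)[OF L] by (simp add: distrib_left)
    then show "x + y \<in> saturation V L" using xy by (auto simp: saturation_def)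
  next
    fix x y :: "'a polynomial" assume x: "x \<in> carrier (poly_ring V)" and y: "y \<in> saturation V L"
    then obtain n where "?w ^ n * y \<in> L" by (auto simp: saturation_def)
    from ideal_poly_ringD(4)[OF L x this] have "?w ^ n * (x * y) \<in> L" by (simp add: mult_ac)
    then show "x * y \<in> saturation V L" using x y by (auto simp: saturation_def)
  qed (use saturation_superset[OF L] ideal_poly_ringD(2)[OF L] in \<open>auto simp: saturation_def\<close>)
next
  let ?w = "\<Prod>v\<in>V. indet v :: 'a polynomial"
  fix v p assume v: "v \<in> V" and p: "p \<in> carrier (poly_ring V)" and vp: "indet v * p \<in> saturation V L"
  then obtain n where n: "?w ^ n * (indet v * p) \<in> L" by (auto simp: saturation_def)
  let ?r = "\<Prod>v\<in>V - {v}. indet v :: 'a polynomial"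
  have "?r \<in> carrier (poly_ring V)" by (intro poly_ring_prod) auto
  from ideal_poly_ringD(4)[OF L this n] have "?r * (?w ^ n * (indet v * p)) \<in> L" .
  moreover have "?w = indet v * ?r" using v V by (simp add: prod.remove)
  ultimately have "?w ^ Suc n * p \<in> L" by (simp add: mult_ac)
  then show "p \<in> saturation V L" unfolding saturation_def using p by blast
qed

lemma saturated_ideal: "saturated V J \<Longrightarrow> ideal J (poly_ring V)"
  by (simp add: saturated_def)

lemma saturatedD:
  "saturated V J \<Longrightarrow> v \<in> V \<Longrightarrow> p \<in> carrier (poly_ring V) \<Longrightarrow> indet v * p \<in> J \<Longrightarrow> p \<in> J"
  by (simp add: saturated_def)

lemma saturated_mult_iff:
  assumes "saturated V J" "v \<in> V" "p \<in> carrier (poly_ring V)"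
  shows "indet v * p \<in> J \<longleftrightarrow> p \<in> J"
  using saturatedD[OF assms] ideal_poly_ringD(4)[OF saturated_ideal[OF assms(1)] poly_ring_indet[OF assms(2)]] by auto

lemma saturated_prod_iff:
  assumes "saturated V J" "\<And>a. a \<in> A \<Longrightarrow> v a \<in> V" "p \<in> carrier (poly_ring V)"
  shows "(\<Prod>a\<in>A. indet (v a)) * p \<in> J \<longleftrightarrow> p \<in> J"
  using assms(2)
proof (induction A rule: infinite_finite_induct)
  case (insert a A)
  have "(\<Prod>a\<in>insert a A. indet (v a)) * p = indet (v a) * ((\<Prod>a\<in>A. indet (v a)) * p)"
    using insert by (simp add: mult_ac)
  moreover have "(\<Prod>a\<in>A. indet (v a)) * p \<in> carrier (poly_ring V)"
    using insert.prems assms(3) by auto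
  ultimately show ?case
    using saturated_mult_iff[OF assms(1), of "v a" "(\<Prod>a\<in>A. indet (v a)) * p"] insert by (metis insertCI)
qed auto

lemma ideal_cong:
  assumes "ideal J (poly_ring V)" "x - y \<in> J"
  shows "x \<in> J \<longleftrightarrow> y \<in> J"
  using ideal_poly_ringD(3)[OF assms(1), of "x - y" y] ideal_poly_ringD(7)[OF assms(1), of x "x - y"] assms(2)
  by auto

lemma ideal_cong_prod:
  assumes J: "ideal J (poly_ring V)" and "\<And>a. a \<in> A \<Longrightarrow> f a - g a \<in> J"
    "\<And>a. a \<in> A \<Longrightarrow> f a \<in> carrier (poly_ring V)" "\<And>a. a \<in> A \<Longrightarrow> g a \<in> carrier (poly_ring V)"
  shows "prod f A - prod g A \<in> J"
  using assms(2-)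
proof (induction A rule: infinite_finite_induct)
  case (insert a A)
  have "prod f (insert a A) - prod g (insert a A) =
    (f a - g a) * prod f A + g a * (prod f A - prod g A)"
    using insert by (simp add: algebra_simps)
  moreover have "(f a - g a) * prod f A \<in> J"
    using insert.prems by (intro ideal_poly_ringD(5)[OF J]) auto
  moreover have "g a * (prod f A - prod g A) \<in> J"
    using insert by (intro ideal_poly_ringD(4)[OF J]) auto
  ultimately show ?case using ideal_poly_ringD(3)[OF J] by simp
qed (use ideal_poly_ringD(2)[OF J] in auto)

text \<open>The linear syzygy between the three minors of the matrix with rows
  \<open>p0 p1 p2\<close> and \<open>q0 q1 q2\<close>. It allows adjacent intervals to be glued, at
  the price of a factor \<open>p1\<close>.\<close>

lemma minor_trans:
  fixes p0 :: "'k::field polynomial"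
  assumes J: "ideal J (poly_ring V)" and "p0 * q1 - q0 * p1 \<in> J" "p1 * q2 - q1 * p2 \<in> J"
    and "p0 \<in> carrier (poly_ring V)" "p2 \<in> carrier (poly_ring V)"
  shows "p1 * (p0 * q2 - q0 * p2) \<in> J"
proof -
  have "p1 * (p0 * q2 - q0 * p2) = p0 * (p1 * q2 - q1 * p2) + p2 * (p0 * q1 - q0 * p1)"
    by (simp add: algebra_simps)
  also have "\<dots> \<in> J"
    using assms by (intro ideal_poly_ringD(3)[OF J] ideal_poly_ringD(4)[OF J]) auto
  finally show ?thesis .
qed

section \<open>Determinants modulo a saturated ideal\<close>

lemma permutes_lt: "p permutes {0..<n} \<Longrightarrow> i < n \<Longrightarrow> p i < (n::nat)"
  using permutes_in_image[of p "{0..<n}" i] by simp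

lemma poly_ring_det:
  assumes "\<And>a b. a < n \<Longrightarrow> b < n \<Longrightarrow> e a b \<in> carrier (poly_ring V)"
  shows "Determinant.det (mat n n (\<lambda>(a, b). e a b)) \<in> carrier (poly_ring V)"
proof -
  have [simp]: "signof p \<in> carrier (poly_ring V)" for p
    by (simp add: sign_def)
  show ?thesis
    unfolding det_def'[OF mat_carrier]
    by (intro poly_ring_sum poly_ring_mult poly_ring_prod)
      (use assms in \<open>auto simp: permutes_lt\<close>)
qed

text \<open>The only permutation avoiding the entries that vanish modulo \<open>J\<close> is \<open>0 \<mapsto> 0, a \<mapsto> n - a\<close>.\<close>
lemma permutes_eq_of_sum_ge:
  fixes \<sigma> :: "nat \<Rightarrow> nat"
  assumes s: "\<sigma> permutes {0..<n}" and ge: "\<And>a. 0 < a \<Longrightarrow> a < n \<Longrightarrow> n \<le> a + \<sigma> a" and "a < n"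
  shows "\<sigma> a = (if a = 0 then 0 else n - a)"
proof -
  have lt: "\<sigma> i < n" if "i < n" for i using permutes_lt[OF s that] .
  have inj: "\<sigma> i = \<sigma> j \<Longrightarrow> i = j" for i j using permutes_inj[OF s] by (auto dest: injD)
  have eq: "\<sigma> a = n - a" if "0 < a" "a < n" for a
    using that
  proof (induction a rule: less_induct)
    case (less a)
    have "n - a \<le> \<sigma> a" using ge[of a] less.prems by simp
    moreover have False if "n - a < \<sigma> a"
    proof -
      let ?c = "n - \<sigma> a"
      have c: "?c < a" "0 < ?c" using that less.prems lt[of a] by auto
      then have "\<sigma> ?c = n - ?c" using less by simp
      then have "\<sigma> ?c = \<sigma> a" using lt[of a] less.prems by simp
      from inj[OF this] show False using c by simp
    qed
    ultimately show ?case using le_neq_implies_less by metis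
  qed
  show ?thesis
  proof (cases "a = 0")
    case True
    have "\<sigma> 0 = 0"
    proof (rule ccontr)
      assume "\<sigma> 0 \<noteq> 0"
      then have "\<sigma> (n - \<sigma> 0) = \<sigma> 0" using eq[of "n - \<sigma> 0"] lt[of 0] \<open>a < n\<close> by simp
      then show False using inj[of "n - \<sigma> 0" 0] lt[of 0] \<open>a < n\<close> by simp
    qed
    then show ?thesis using True by simp
  qed (use eq \<open>a < n\<close> in simp)
qed

lemma signof_mult_in_ideal_iff:
  assumes "ideal J (poly_ring V)"
  shows "signof p * x \<in> J \<longleftrightarrow> (x :: 'k::field polynomial) \<in> J"
  using ideal_poly_ringD(6)[OF assms, of x] ideal_poly_ringD(6)[OF assms, of "- x"]
  by (auto simp: sign_def)

text \<open>In the Leibniz expansion every permutation other than \<open>0 -> 0, a -> n - a\<close>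
  picks an entry with \<open>a + b < n\<close> in some row \<open>a > 0\<close>, so its term lies in
  \<open>J\<close>. The remaining term decides membership, up to sign.\<close>

lemma det_in_ideal_iff:
  assumes J: "ideal J (poly_ring V)"
    and car: "\<And>a b. a < n \<Longrightarrow> b < n \<Longrightarrow> N a b \<in> carrier (poly_ring V)"
    and zero: "\<And>a b. 0 < a \<Longrightarrow> a + b < n \<Longrightarrow> N a b \<in> J"
    and n: "0 < n"
  shows "Determinant.det (mat n n (\<lambda>(a, b). N a b)) \<in> J \<longleftrightarrow> N 0 0 * (\<Prod>a=1..<n. N a (n - a)) \<in> J"
proof -
  \<comment> \<open>Outside \<open>{0..<n}\<close> the map must be the identity to satisfy
    \<open>permutes\<close>.\<close>
  define \<tau> where "\<tau> a = (if a = 0 then 0 else if a < n then n - a else a)" for a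
  let ?P = "{p. p permutes {0..<n}}"
  let ?t = "\<lambda>p. signof p * (\<Prod>i=0..<n. N i (p i))"
  have tau: "\<tau> permutes {0..<n}"
  proof (rule bij_imp_permutes)
    show "bij_betw \<tau> {0..<n} {0..<n}"
      by (rule bij_betwI[of _ _ _ \<tau>]) (auto simp: \<tau>_def)
  qed (auto simp: \<tau>_def)
  have "?t p \<in> J" if p: "p \<in> ?P - {\<tau>}" for p
  proof -
    have pp: "p permutes {0..<n}" using p by simp
    have "\<exists>a. 0 < a \<and> a < n \<and> a + p a < n"
    proof (rule ccontr)
      assume "\<not> ?thesis"
      then have *: "p a = (if a = 0 then 0 else n - a)" if "a < n" for a
        using permutes_eq_of_sum_ge[OF pp _ that] by (meson not_less)
      have "p a = \<tau> a" for a
        using *[of a] permutes_not_in[OF pp, of a] by (cases "a < n") (auto simp: \<tau>_def n)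
      then show False using p by auto
    qed
    then obtain a where a: "0 < a" "a < n" "a + p a < n" by blast
    have c: "N i (p i) \<in> carrier (poly_ring V)" if "i < n" for i
      using car that permutes_lt[OF pp] by simp
    have "(\<Prod>i=0..<n. N i (p i)) = N a (p a) * (\<Prod>i\<in>{0..<n}-{a}. N i (p i))"
      using a by (intro prod.remove) auto
    also have "\<dots> \<in> J"
      by (rule ideal_poly_ringD(5)[OF J zero[OF a(1,3)]], rule poly_ring_prod) (use c in auto)
    finally show ?thesis using signof_mult_in_ideal_iff[OF J] by simp
  qed
  then have rest: "sum ?t (?P - {\<tau>}) \<in> J" by (intro ideal_sum[OF J])
  have "Determinant.det (mat n n (\<lambda>(a, b). N a b)) = sum ?t ?P"
    unfolding det_def'[OF mat_carrier]
    by (intro sum.cong prod.cong arg_cong2[where f = "(*)"]) (auto simp: permutes_lt)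
  also have "\<dots> = ?t \<tau> + sum ?t (?P - {\<tau>})"
    using tau by (intro sum.remove) (auto simp: finite_permutations)
  finally have d: "Determinant.det (mat n n (\<lambda>(a, b). N a b)) - ?t \<tau> = sum ?t (?P - {\<tau>})" by simp
  have "(\<Prod>i=0..<n. N i (\<tau> i)) = N 0 0 * (\<Prod>a=1..<n. N a (n - a))"
    unfolding prod.atLeast_Suc_lessThan[OF n]
    by (intro arg_cong2[where f = "(*)"] prod.cong) (auto simp: \<tau>_def)
  moreover have "Determinant.det (mat n n (\<lambda>(a, b). N a b)) \<in> J \<longleftrightarrow> ?t \<tau> \<in> J"
    by (rule ideal_cong[OF J]) (use d rest in simp)
  ultimately show ?thesis using signof_mult_in_ideal_iff[OF J] by simp
qed

text \<open>Left multiplication by the lower bidiagonal matrix \<open>E\<close> replaces row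
  \<open>a > 0\<close> by \<open>e (a - 1) 0\<close> times row \<open>a\<close> minus
  \<open>e a 0\<close> times row \<open>a - 1\<close>; the determinant of \<open>E\<close> is the
  product of its diagonal.\<close>

lemma det_row_ops:
  fixes e :: "nat \<Rightarrow> nat \<Rightarrow> 'a::comm_ring_1"
  assumes "0 < n"
  shows "Determinant.det (mat n n (\<lambda>(a, b). if a = 0 then e 0 b
       else e (a - 1) 0 * e a b - e (a - 1) b * e a 0)) =
     (\<Prod>a=1..<n. e (a - 1) 0) * Determinant.det (mat n n (\<lambda>(a, b). e a b))"
proof -
  define E where "E = mat n n (\<lambda>(a, b). if a = b then (if a = 0 then 1 else e (a - 1) 0)
     else if a = Suc b then - e a 0 else 0)"
  let ?M = "mat n n (\<lambda>(a, b). e a b)"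
  have E: "E \<in> carrier_mat n n" by (simp add: E_def)
  have "mat n n (\<lambda>(a, b). if a = 0 then e 0 b else e (a - 1) 0 * e a b - e (a - 1) b * e a 0) = E * ?M"
    (is "?N = _")
  proof (rule eq_matI)
    fix a b assume "a < dim_row (E * ?M)" "b < dim_col (E * ?M)"
    then have ab: "a < n" "b < n" by (simp_all add: E_def)
    have "(E * ?M) $$ (a, b) = (\<Sum>i=0..<n. E $$ (a, i) * e i b)"
      using ab by (simp add: E_def scalar_prod_def)
    \<comment> \<open>For \<open>a = 0\<close> truncated subtraction gives \<open>a - 1 = a\<close>,
      so the second summand has to be set to 0 explicitly.\<close>
    also have "\<dots> = (\<Sum>i=0..<n. (if i = a then (if a = 0 then 1 else e (a - 1) 0) * e i b else 0)
        + (if i = a - 1 then (if a = 0 then 0 else - e a 0 * e i b) else 0))"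
      using ab by (intro sum.cong) (auto simp: E_def)
    also have "\<dots> = (if a = 0 then e 0 b else e (a - 1) 0 * e a b - e (a - 1) b * e a 0)"
      using ab by (simp add: sum.distrib sum.delta mult.commute)
    finally show "?N $$ (a, b) = (E * ?M) $$ (a, b)" using ab by simp
  qed (simp_all add: E_def)
  moreover have "Determinant.det E = prod_list (diag_mat E)"
    by (rule det_lower_triangular[OF _ E]) (auto simp: E_def)
  moreover have "prod_list (diag_mat E) = (\<Prod>a=1..<n. e (a - 1) 0)"
    using assms by (simp add: prod_list_diag_prod prod.atLeast_Suc_lessThan[OF assms] E_def)
  ultimately show ?thesis
    using det_mult[OF E, of ?M] by simp
qed

section \<open>Minors of rectangles in saturated ideals\<close>

definition minor :: "vertex \<Rightarrow> vertex \<Rightarrow> 'k::field polynomial" where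
  "minor a b = indet a * indet b - indet (fst a, snd b) * indet (fst b, snd a)"

abbreviation cell_minor :: "vertex \<Rightarrow> 'k::field polynomial" where
  "cell_minor c \<equiv> minor c (upper_right c)"

lemma poly_ring_minor:
  assumes "a \<in> V" "b \<in> V" "(fst a, snd b) \<in> V" "(fst b, snd a) \<in> V"
  shows "minor a b \<in> carrier (poly_ring V)"
  unfolding minor_def using assms by (intro poly_ring_diff poly_ring_mult poly_ring_indet)

text \<open>The intervals share the horizontal edge at height \<open>l\<close>. The syzygy for the
  heights \<open>j\<close>, \<open>l\<close>, \<open>l'\<close> yields the large minor times the
  variable at the left end of that edge, and saturation cancels the variable.\<close>

lemma minor_extend_up:
  assumes J: "saturated V J" and "minor (x, j) (x', l) \<in> J" "minor (x, l) (x', l') \<in> J"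
    and V: "{x, x'} \<times> {j, l, l'} \<subseteq> V"
  shows "minor (x, j) (x', l') \<in> J"
proof (rule saturatedD[OF J])
  show "indet (x, l) * minor (x, j) (x', l') \<in> J"
    using minor_trans[OF saturated_ideal[OF J], of "indet (x, j)" "indet (x', l)" "indet (x', j)"
        "indet (x, l)" "indet (x', l')" "indet (x, l')"] assms
    by (simp add: minor_def mult.commute)
qed (use V in \<open>auto intro!: poly_ring_minor\<close>)

text \<open>As before, for a common vertical edge; the variable at its lower end is
  cancelled.\<close>

lemma minor_extend_right:
  assumes J: "saturated V J" and "minor (i, j) (k, l) \<in> J" "minor (k, j) (k', l) \<in> J"
    and V: "{i, k, k'} \<times> {j, l} \<subseteq> V"
  shows "minor (i, j) (k', l) \<in> J"
proof (rule saturatedD[OF J])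
  show "indet (k, j) * minor (i, j) (k', l) \<in> J"
    using minor_trans[OF saturated_ideal[OF J], of "indet (i, j)" "indet (k, l)" "indet (i, l)"
        "indet (k, j)" "indet (k', l)" "indet (k', j)"] assms
    by (simp add: minor_def)
qed (use V in \<open>auto intro!: poly_ring_minor\<close>)

text \<open>Cells are first stacked into strips of width one, then the strips are joined from left
  to right.\<close>

lemma minor_in_saturated:
  assumes J: "saturated V J" and "i < k" "j < l"
    and V: "{i..k} \<times> {j..l} \<subseteq> V"
    and cells: "\<And>x y. i \<le> x \<Longrightarrow> x < k \<Longrightarrow> j \<le> y \<Longrightarrow> y < l \<Longrightarrow> cell_minor (x, y) \<in> J"
  shows "minor (i, j) (k, l) \<in> J"
proof -
  have row: "minor (x, j) (Suc x, l') \<in> J" if x: "i \<le> x" "x < k" and "Suc j \<le> l'" "l' \<le> l" for x l'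
    using \<open>Suc j \<le> l'\<close> \<open>l' \<le> l\<close>
  proof (induction l' rule: dec_induct)
    case base
    then show ?case using cells[of x j] x \<open>j < l\<close> by (simp add: upper_right_def)
  next
    case (step l')
    have "cell_minor (x, l') \<in> J" using cells[of x l'] x step by simp
    then have "minor (x, l') (Suc x, Suc l') \<in> J" by (simp add: upper_right_def)
    moreover have "minor (x, j) (Suc x, l') \<in> J" using step by simp
    moreover have "{x, Suc x} \<times> {j, l', Suc l'} \<subseteq> {i..k} \<times> {j..l}" using x step by auto
    ultimately show ?case using minor_extend_up[OF J _ _ order_trans[OF _ V]] by simp
  qed
  have "minor (i, j) (k', l) \<in> J" if "Suc i \<le> k'" "k' \<le> k" for k'
    using that
  proof (induction k' rule: dec_induct)
    case base
    then show ?case using row[of i l] \<open>j < l\<close> by simp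
  next
    case (step k')
    have "minor (k', j) (Suc k', l) \<in> J" using row[of k' l] \<open>j < l\<close> step by simp
    moreover have "minor (i, j) (k', l) \<in> J" using step by simp
    moreover have "{i, k', Suc k'} \<times> {j, l} \<subseteq> {i..k} \<times> {j..l}" using \<open>j < l\<close> step by auto
    ultimately show ?case using minor_extend_right[OF J _ _ order_trans[OF _ V]] by simp
  qed
  then show ?thesis using \<open>i < k\<close> by simp
qed

text \<open>Modulo the minors below the antidiagonal, the lower-left triangle of the matrix has rank one;
  subtracting multiples of consecutive rows makes the matrix antitriangular, with the cell minors
  along the antidiagonal, up to monomial factors.\<close>
lemma antidiagonal_det_in_saturated_iff:
  fixes i j n :: nat and V :: "vertex set"
  defines "e \<equiv> \<lambda>a b. if (i + a, j + b) \<in> V then indet (i + a, j + b) else (0 :: 'k::field polynomial)"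
  assumes J: "saturated V J" and n: "0 < n"
    and V: "\<And>a b. a < n \<Longrightarrow> b < n \<Longrightarrow> a + b \<le> n \<Longrightarrow> (i + a, j + b) \<in> V"
    and cells: "\<And>a b. a + b + 2 < n \<Longrightarrow> cell_minor (i + a, j + b) \<in> J"
  shows "Determinant.det (mat n n (\<lambda>(a, b). e a b)) \<in> J \<longleftrightarrow>
    (\<Prod>a=1..<n. cell_minor (i + (a - 1), j + (n - a - 1))) \<in> J"
proof -
  note I = saturated_ideal[OF J]
  \<comment> \<open>The entries after the operations of \<open>det_row_ops\<close>: row 0 is kept,
    and column 0 becomes 0 in all other rows.\<close>
  define N where "N a b = (if a = 0 then e 0 b else e (a - 1) 0 * e a b - e (a - 1) b * e a 0)" for a b
  let ?m = "\<lambda>a. cell_minor (i + (a - 1), j + (n - a - 1)) :: 'k polynomial"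
  have e: "e a b \<in> carrier (poly_ring V)" for a b by (simp add: e_def)
  have e_eq: "e a b = indet (i + a, j + b)" if "a < n" "b < n" "a + b \<le> n" for a b
    using V[OF that] by (simp add: e_def)
  have N: "N a b \<in> carrier (poly_ring V)" for a b using e by (auto simp: N_def)
  \<comment> \<open>For \<open>b > 0\<close> such an entry is the minor of a strip of width one
    whose cells all lie strictly below the antidiagonal ones.\<close>
  have NJ: "N a b \<in> J" if a: "0 < a" "a + b < n" for a b
  proof (cases "b = 0")
    case False
    have "minor (i + (a - 1), j) (i + a, j + b) \<in> J"
    proof (rule minor_in_saturated[OF J])
      fix x y assume "i + (a - 1) \<le> x" "x < i + a" "j \<le> y" "y < j + b"
      then show "cell_minor (x, y) \<in> J" using cells[of "x - i" "y - j"] a by simp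
    next
      show "{i + (a - 1)..i + a} \<times> {j..j + b} \<subseteq> V"
      proof clarify
        fix x y assume "x \<in> {i + (a - 1)..i + a}" "y \<in> {j..j + b}"
        then show "(x, y) \<in> V" using V[of "x - i" "y - j"] a by auto
      qed
    qed (use a False in auto)
    then show ?thesis using a by (simp add: N_def e_eq minor_def)
  qed (use ideal_poly_ringD(2)[OF I] a in \<open>simp add: N_def\<close>)
  \<comment> \<open>The syzygy again, for the columns \<open>0\<close>, \<open>n - a - 1\<close> and
    \<open>n - a\<close>: it trades the entry of \<open>N\<close> for the cell minor at the
    antidiagonal, up to a multiple of \<open>N a (n - a - 1)\<close>, which lies in
    \<open>J\<close>.\<close>
  have anti: "indet (i + (a - 1), j + (n - a - 1)) * N a (n - a) - indet (i + (a - 1), j) * ?m a \<in> J"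
    if a: "a \<in> {1..<n}" for a
  proof -
    define p q where "p = a - 1" and "q = n - a - 1"
    then have pq: "a = Suc p" "n = p + q + 2" using a by auto
    have "indet (i + (a - 1), j + (n - a - 1)) * N a (n - a) - indet (i + (a - 1), j) * ?m a
      = e (a - 1) (n - a) * N a (n - a - 1)"
      by (simp add: N_def e_eq minor_def upper_right_def algebra_simps pq)
    also have "\<dots> \<in> J" using a by (intro ideal_poly_ringD(4)[OF I] e NJ) auto
    finally show ?thesis .
  qed
  have m: "?m a \<in> carrier (poly_ring V)" if a: "a \<in> {1..<n}" for a
  proof -
    define p q where "p = a - 1" and "q = n - a - 1"
    then have pq: "a = Suc p" "n = p + q + 2" using a by auto
    show ?thesis
      using V[of p q] V[of p "Suc q"] V[of "Suc p" q] V[of "Suc p" "Suc q"]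
      by (intro poly_ring_minor) (auto simp: upper_right_def pq)
  qed
  have V1: "(i + (a - 1), j) \<in> V" "(i + (a - 1), j + (n - a - 1)) \<in> V" if "a \<in> {1..<n}" for a
    using that V[of "a - 1" 0] V[of "a - 1" "n - a - 1"] by auto
  have D: "Determinant.det (mat n n (\<lambda>(a, b). e a b)) \<in> carrier (poly_ring V)"
    using e by (intro poly_ring_det)
  \<comment> \<open>Saturation inserts and removes all monomial factors. Multiplying by the
    variables of column 0, except the last, turns the determinant into that of
    \<open>N\<close>.\<close>
  have "Determinant.det (mat n n (\<lambda>(a, b). e a b)) \<in> J \<longleftrightarrow>
      (\<Prod>a=1..<n. indet (i + (a - 1), j)) * Determinant.det (mat n n (\<lambda>(a, b). e a b)) \<in> J"
    by (rule saturated_prod_iff[OF J _ D, symmetric]) (use V1 in auto)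
  also have "(\<Prod>a=1..<n. indet (i + (a - 1), j)) = (\<Prod>a=1..<n. e (a - 1) 0)"
    by (intro prod.cong) (auto simp: e_eq)
  also have "\<dots> * Determinant.det (mat n n (\<lambda>(a, b). e a b)) = Determinant.det (mat n n (\<lambda>(a, b). N a b))"
    unfolding N_def by (rule det_row_ops[OF n, symmetric])
  also have "\<dots> \<in> J \<longleftrightarrow> N 0 0 * (\<Prod>a=1..<n. N a (n - a)) \<in> J"
    by (rule det_in_ideal_iff[OF I]) (use N NJ n in auto)
  also have "N 0 0 = indet (i, j)" using n e_eq[of 0 0] by (simp add: N_def)
  also have "indet (i, j) * (\<Prod>a=1..<n. N a (n - a)) \<in> J \<longleftrightarrow> (\<Prod>a=1..<n. N a (n - a)) \<in> J"
    using V[of 0 0] n N by (intro saturated_mult_iff[OF J] poly_ring_prod) auto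
  also have "\<dots> \<longleftrightarrow> (\<Prod>a=1..<n. indet (i + (a - 1), j + (n - a - 1))) * (\<Prod>a=1..<n. N a (n - a)) \<in> J"
    by (rule saturated_prod_iff[OF J, symmetric]) (use V1 N in auto)
  also have "\<dots> \<longleftrightarrow> (\<Prod>a=1..<n. indet (i + (a - 1), j + (n - a - 1)) * N a (n - a)) \<in> J"
    by (simp add: prod.distrib)
  also have "\<dots> \<longleftrightarrow> (\<Prod>a=1..<n. indet (i + (a - 1), j) * ?m a) \<in> J"
    by (intro ideal_cong[OF I] ideal_cong_prod[OF I] anti poly_ring_mult poly_ring_indet N m V1)
  also have "\<dots> \<longleftrightarrow> (\<Prod>a=1..<n. indet (i + (a - 1), j)) * (\<Prod>a=1..<n. ?m a) \<in> J"
    by (simp add: prod.distrib)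
  also have "\<dots> \<longleftrightarrow> (\<Prod>a=1..<n. ?m a) \<in> J"
    using V1 m by (intro saturated_prod_iff[OF J] poly_ring_prod)
  finally show ?thesis .
qed

section \<open>Toric ideals of collections of cells\<close>

text \<open>The multidegree of a monomial when \<open>x_v\<close> has degree
  \<open>\<sigma> v\<close> in the free abelian group on the vertices; \<open>grading\<close> is the
  integer-valued counterpart.\<close>

definition weight :: "(vertex \<Rightarrow> vertex \<Rightarrow>\<^sub>0 int) \<Rightarrow> monomial \<Rightarrow> vertex \<Rightarrow>\<^sub>0 int" where
  "weight \<sigma> u = (\<Sum>v\<in>keys u. frag_cmul (int (lookup u v)) (\<sigma> v))"

definition grading :: "(vertex \<Rightarrow> int) \<Rightarrow> monomial \<Rightarrow> int" where
  "grading \<psi> u = (\<Sum>v\<in>keys u. int (lookup u v) * \<psi> v)"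

lemma weight_add: "weight \<sigma> (u + v) = weight \<sigma> u + weight \<sigma> v"
  unfolding weight_def by (rule setsum_keys_plus_distrib) (simp_all add: frag_cmul_distrib)

lemma weight_zero [simp]: "weight \<sigma> 0 = 0"
  by (simp add: weight_def)

lemma weight_single [simp]: "weight \<sigma> (single v n) = frag_cmul (int n) (\<sigma> v)"
  by (cases "n = 0") (simp_all add: weight_def)

lemma lookup_weight: "lookup (weight \<sigma> u) t = grading (\<lambda>v. lookup (\<sigma> v) t) u"
  by (simp add: weight_def grading_def lookup_sum)

text \<open>The homomorphism that sends \<open>x_v\<close> to the Laurent monomial with exponent
  \<open>\<sigma> v\<close>. Its target is the Laurent polynomial ring, realized as the group
  algebra of a free abelian group.\<close>

definition laurent :: "(vertex \<Rightarrow> vertex \<Rightarrow>\<^sub>0 int) \<Rightarrow> 'k::field polynomial \<Rightarrow> (vertex \<Rightarrow>\<^sub>0 int) \<Rightarrow>\<^sub>0 'k" where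
  "laurent \<sigma> p = (\<Sum>u\<in>keys p. single (weight \<sigma> u) (lookup p u))"

lemma single_one_inject: "single a (1 :: 'b::zero_neq_one) = single b 1 \<longleftrightarrow> a = b"
  by (metis keys_single singleton_inject zero_neq_one)

lemma sum_single_keys: "(\<Sum>u\<in>keys p. single u (lookup p u)) = p"
proof (rule poly_mapping_eqI)
  fix k
  have "lookup (\<Sum>u\<in>keys p. single u (lookup p u)) k = (\<Sum>u\<in>keys p. if u = k then lookup p u else 0)"
    by (simp add: lookup_sum lookup_single when_def)
  then show "lookup (\<Sum>u\<in>keys p. single u (lookup p u)) k = lookup p k"
    by (simp add: in_keys_iff)
qed

lemma laurent_add: "laurent \<sigma> (p + q) = laurent \<sigma> p + laurent \<sigma> q"
  unfolding laurent_def by (rule setsum_keys_plus_distrib) (simp_all add: single_add)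

lemma laurent_zero [simp]: "laurent \<sigma> 0 = 0"
  by (simp add: laurent_def)

lemma laurent_single [simp]: "laurent \<sigma> (single u c) = single (weight \<sigma> u) c"
  by (cases "c = 0") (simp_all add: laurent_def)

lemma laurent_uminus: "laurent \<sigma> (- p) = - laurent \<sigma> p"
  using laurent_add[of \<sigma> p "- p"] by (simp add: minus_unique)

lemma laurent_diff: "laurent \<sigma> (p - q) = laurent \<sigma> p - laurent \<sigma> q"
  using laurent_add[of \<sigma> p "- q"] by (simp add: laurent_uminus)

lemma laurent_sum: "laurent \<sigma> (sum f A) = (\<Sum>a\<in>A. laurent \<sigma> (f a))"
  by (induction A rule: infinite_finite_induct) (simp_all add: laurent_add)

lemma laurent_mult: "laurent \<sigma> (p * q) = laurent \<sigma> p * laurent \<sigma> q"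
proof -
  have "p * q = (\<Sum>u\<in>keys p. single u (lookup p u)) * (\<Sum>v\<in>keys q. single v (lookup q v))"
    by (simp only: sum_single_keys)
  also have "\<dots> = (\<Sum>u\<in>keys p. \<Sum>v\<in>keys q. single (u + v) (lookup p u * lookup q v))"
    by (simp add: sum_product mult_single)
  also have "laurent \<sigma> \<dots> = laurent \<sigma> p * laurent \<sigma> q"
    by (simp add: laurent_sum weight_add laurent_def[of _ p] laurent_def[of _ q] sum_product mult_single)
  finally show ?thesis .
qed

lemma laurent_one [simp]: "laurent \<sigma> 1 = 1"
  by (metis laurent_single single_one weight_zero)

lemma laurent_prod: "laurent \<sigma> (prod f A) = (\<Prod>a\<in>A. laurent \<sigma> (f a))"
  by (induction A rule: infinite_finite_induct) (simp_all add: laurent_mult)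

lemma laurent_indet: "laurent \<sigma> (indet v) = single (\<sigma> v) 1"
  by (simp add: indet_def)

text \<open>The kernel of a monomial map is spanned by differences of monomials of equal weight.
  Terms are removed by induction on the size of the support.\<close>

lemma laurent_kernel_in_ideal:
  assumes J: "ideal J (poly_ring V)" and "p \<in> carrier (poly_ring V)" "laurent \<sigma> p = 0"
    and bin: "\<And>u v. u \<in> monomials V \<Longrightarrow> v \<in> monomials V \<Longrightarrow> weight \<sigma> u = weight \<sigma> v \<Longrightarrow>
      single u 1 - single v 1 \<in> J"
  shows "p \<in> J"
  using assms(2,3)
proof (induction "card (keys p)" arbitrary: p rule: less_induct)
  case less
  show ?case
  proof (cases "p = 0")
    case True
    then show ?thesis using ideal_poly_ringD(2)[OF J] by simp
  next
    case False
    then obtain u where u: "u \<in> keys p" by (metis keys_eq_empty equals0I)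
    \<comment> \<open>The coefficient of \<open>laurent \<sigma> p\<close> at the weight of
      \<open>u\<close> is zero, so another monomial of \<open>p\<close> must cancel the contribution
      of \<open>u\<close>.\<close>
    have "\<exists>v\<in>keys p - {u}. weight \<sigma> v = weight \<sigma> u"
    proof (rule ccontr)
      assume neg: "\<not> ?thesis"
      have "lookup (laurent \<sigma> p) (weight \<sigma> u) = (\<Sum>v\<in>keys p. lookup p v when weight \<sigma> v = weight \<sigma> u)"
        by (simp add: laurent_def lookup_sum lookup_single)
      also have "\<dots> = (\<Sum>v\<in>keys p. if v = u then lookup p u else 0)"
        using neg by (intro sum.cong) (auto simp: when_def)
      also have "\<dots> \<noteq> 0" using u by (simp add: in_keys_iff)
      finally show False using less.prems by simp
    qed
    then obtain v where v: "v \<in> keys p" "v \<noteq> u" "weight \<sigma> v = weight \<sigma> u" by blast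
    have uv: "u \<in> monomials V" "v \<in> monomials V"
      using less.prems(1) u v(1) by (auto simp: in_poly_ring_iff monomials_def)
    \<comment> \<open>Subtracting \<open>b\<close> removes \<open>u\<close> and creates no new
      monomial, as \<open>v\<close> already occurs in \<open>p\<close>.\<close>
    define b where "b = single 0 (lookup p u) * (single u 1 - single v 1 :: 'a polynomial)"
    have b: "b = single u (lookup p u) - single v (lookup p u)"
      by (simp add: b_def right_diff_distrib mult_single)
    have bJ: "b \<in> J"
      unfolding b_def using bin[OF uv] v(3) by (intro ideal_poly_ringD(4)[OF J] poly_ring_single) auto
    have sub: "keys (p - b) \<subseteq> keys p - {u}"
      using v u by (auto simp: b in_keys_iff lookup_minus lookup_single when_def split: if_splits)
    have "card (keys (p - b)) < card (keys p)"
      using sub u by (intro psubset_card_mono) auto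
    moreover have "p - b \<in> carrier (poly_ring V)"
      using less.prems(1) bJ ideal_poly_ringD(1)[OF J] by auto
    moreover have "laurent \<sigma> (p - b) = 0"
      using less.prems(2) v(3) by (simp add: laurent_diff b)
    ultimately have "p - b \<in> J" by (rule less.hyps)
    then show ?thesis using ideal_poly_ringD(3)[OF J _ bJ] by force
  qed
qed

text \<open>Solving the cell relations for the upper-right vertices identifies \<open>\<int>\<^sup>V\<close> modulo the lattice
  spanned by the cells of \<open>D\<close> with a free abelian group.\<close>
fun toric :: "cells \<Rightarrow> vertex \<Rightarrow> vertex \<Rightarrow>\<^sub>0 int" where
  "toric D (Suc x, Suc y) =
     (if (x, y) \<in> D then toric D (x, Suc y) + toric D (Suc x, y) - toric D (x, y)
      else single (Suc x, Suc y) 1)"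
| "toric D (0, y) = single (0, y) 1"
| "toric D (x, 0) = single (x, 0) 1"

text \<open>For values in an abelian group: the linear extension of \<open>\<psi>\<close> vanishes
  on the lattice spanned by the cells of \<open>D\<close>.\<close>

definition cell_additive :: "cells \<Rightarrow> (vertex \<Rightarrow> 'g::plus) \<Rightarrow> bool" where
  "cell_additive D \<psi> \<longleftrightarrow> (\<forall>c\<in>D. \<psi> c + \<psi> (upper_right c) = \<psi> (upper_left c) + \<psi> (lower_right c))"

lemma cell_additive_toric: "cell_additive D (toric D)"
  by (auto simp: cell_additive_def upper_left_def upper_right_def lower_right_def)

lemma cell_additive_mono: "cell_additive D' \<psi> \<Longrightarrow> D \<subseteq> D' \<Longrightarrow> cell_additive D \<psi>"
  by (auto simp: cell_additive_def)

text \<open>The recursion only moves left and down. Hence the upper-right corner of a cell cannot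
  occur in the degrees of the other three corners.\<close>

lemma toric_keys: "v \<in> keys (toric D w) \<Longrightarrow> fst v \<le> fst w \<and> snd v \<le> snd w"
proof (induction D w rule: toric.induct)
  case (1 D x y)
  have "keys (toric D (x, Suc y) + toric D (Suc x, y) - toric D (x, y)) \<subseteq>
    keys (toric D (x, Suc y)) \<union> keys (toric D (Suc x, y)) \<union> keys (toric D (x, y))"
    using Poly_Mapping.keys_add keys_diff by fast
  then show ?case using 1 by (auto split: if_splits)
qed auto

text \<open>\<open>toric D\<close> is universal among cell-additive maps: replacing each basis
  vector \<open>w\<close> by \<open>\<psi> w\<close> turns its recursion into the additivity of
  \<open>\<psi>\<close>.\<close>

lemma toric_eval:
  assumes "cell_additive D \<psi>"
  shows "(\<Sum>w\<in>keys (toric D v). lookup (toric D v) w * \<psi> w) = (\<psi> v :: int)"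
proof -
  define E where "E g = (\<Sum>w\<in>keys g. lookup g w * \<psi> w)" for g
  have add: "E (g + h) = E g + E h" for g h
    unfolding E_def by (rule setsum_keys_plus_distrib) (simp_all add: distrib_right)
  have diff: "E (g - h) = E g - E h" for g h
    using add[of "g - h" h] by simp
  have single: "E (single w 1) = \<psi> w" for w by (simp add: E_def)
  have "E (toric D v) = \<psi> v"
    using assms
  proof (induction D v rule: toric.induct)
    case (1 D x y)
    show ?case
    proof (cases "(x, y) \<in> D")
      case True
      then have "\<psi> (x, y) + \<psi> (Suc x, Suc y) = \<psi> (x, Suc y) + \<psi> (Suc x, y)"
        using 1(4) by (auto simp: cell_additive_def upper_left_def upper_right_def lower_right_def)
      then show ?thesis using 1 True by (simp add: add diff)
    qed (simp add: single)
  qed (simp_all add: single)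
  then show ?thesis by (simp add: E_def)
qed

text \<open>A cell-additive integer function factors through \<open>toric D\<close>, so the weight
  determines the degree that it defines.\<close>

lemma grading_eq_of_weight_eq:
  assumes "cell_additive D \<psi>" and "weight (toric D) u = weight (toric D) v"
  shows "grading \<psi> u = grading \<psi> v"
proof -
  define E where "E g = (\<Sum>w\<in>keys g. lookup g w * \<psi> w)" for g
  have add: "E (g + h) = E g + E h" for g h
    unfolding E_def by (rule setsum_keys_plus_distrib) (simp_all add: distrib_right)
  have sum: "E (sum f A) = (\<Sum>a\<in>A. E (f a))" for f :: "vertex \<Rightarrow> _" and A
    by (induction A rule: infinite_finite_induct) (simp_all add: add, simp_all add: E_def)
  have cmul: "E (frag_cmul c g) = c * E g" for c g
  proof (cases "c = 0")
    case False
    then have "keys (frag_cmul c g) = keys g" using keys_cmul_iff by blast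
    then show ?thesis by (simp add: E_def sum_distrib_left mult.assoc)
  qed (simp add: E_def)
  have "grading \<psi> u = E (weight (toric D) u)" for u
    unfolding weight_def sum cmul using toric_eval[OF assms(1)] by (simp add: E_def grading_def)
  then show ?thesis using assms(2) by simp
qed

section \<open>The lattice ideals \<open>T(D)\<close>: primality, cell minors, monotonicity\<close>

definition toric_ideal :: "vertex set \<Rightarrow> cells \<Rightarrow> 'k::field polynomial set" where
  "toric_ideal V D = {p \<in> carrier (poly_ring V). laurent (toric D) p = 0}"

lemma ideal_toric_ideal: "ideal (toric_ideal V D) (poly_ring V)"
  by (rule ideal_poly_ringI) (auto simp: toric_ideal_def laurent_add laurent_mult)

text \<open>The target of \<open>laurent\<close> is a domain, because its exponent group can be
  linearly ordered.\<close>

lemma toric_ideal_prime: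
  assumes "p * q \<in> toric_ideal V D" "p \<in> carrier (poly_ring V)" "q \<notin> toric_ideal V D"
    "q \<in> carrier (poly_ring V)"
  shows "p \<in> toric_ideal V D"
  using assms by (auto simp: toric_ideal_def laurent_mult)

lemma indet_notin_toric_ideal: "indet v \<notin> toric_ideal V D"
  by (simp add: toric_ideal_def laurent_indet flip: keys_eq_empty)

lemma saturated_toric_ideal: "saturated V (toric_ideal V D)"
  unfolding saturated_def
proof (intro conjI ballI impI)
  fix v p assume "v \<in> V" "p \<in> carrier (poly_ring V)" "indet v * p \<in> toric_ideal V D"
  then show "p \<in> toric_ideal V D"
    using toric_ideal_prime[of p "indet v" V D] indet_notin_toric_ideal[of v V D] poly_ring_indet[of v V]
    by (metis mult.commute)
qed (rule ideal_toric_ideal)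

lemma prod_notin_toric_ideal:
  assumes "\<And>a. a \<in> A \<Longrightarrow> f a \<in> carrier (poly_ring V)" "\<And>a. a \<in> A \<Longrightarrow> f a \<notin> toric_ideal V D"
  shows "prod f A \<notin> toric_ideal V D"
proof (cases "finite A")
  case True
  then show ?thesis using assms by (auto simp: toric_ideal_def laurent_prod)
qed (simp add: toric_ideal_def)

lemma laurent_minor:
  "laurent \<sigma> (minor a b) =
     single (\<sigma> a + \<sigma> b) 1 - single (\<sigma> (fst a, snd b) + \<sigma> (fst b, snd a)) 1"
  by (simp add: minor_def laurent_diff laurent_mult laurent_indet mult_single)

lemma cell_minor_in_toric_ideal:
  assumes "c \<in> D" "cell c \<subseteq> V"
  shows "cell_minor c \<in> toric_ideal V D"
proof -
  have "toric D c + toric D (upper_right c) =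
      toric D (fst c, snd (upper_right c)) + toric D (fst (upper_right c), snd c)"
    using cell_additive_toric[of D] assms(1)
    by (auto simp: cell_additive_def upper_right_def upper_left_def lower_right_def)
  moreover have "cell_minor c \<in> carrier (poly_ring V)"
    by (cases c, rule poly_ring_minor) (use assms(2) in \<open>auto simp: cell_def interval_def upper_right_def\<close>)
  ultimately show ?thesis by (simp add: toric_ideal_def laurent_minor)
qed

text \<open>For \<open>c\<close> outside \<open>D\<close>, the degree of the upper-right vertex is a
  basis vector that occurs in the degree of none of the other corners, so the two terms of the minor
  have different weights.\<close>

lemma cell_minor_notin_toric_ideal:
  assumes "c \<notin> D"
  shows "cell_minor c \<notin> toric_ideal V D"
proof
  assume "cell_minor c \<in> toric_ideal V D"
  then have eq: "toric D c + toric D (upper_right c) =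
      toric D (fst c, snd (upper_right c)) + toric D (fst (upper_right c), snd c)" (is "?l = ?r")
    by (simp add: toric_ideal_def laurent_minor single_one_inject)
  have "toric D (upper_right c) = single (upper_right c) 1"
    using assms by (cases c) (simp add: upper_right_def)
  moreover have "upper_right c \<notin> keys (toric D c)"
    "upper_right c \<notin> keys (toric D (fst c, snd (upper_right c)))"
    "upper_right c \<notin> keys (toric D (fst (upper_right c), snd c))"
    using toric_keys[of "upper_right c" D] by (fastforce simp: upper_right_def)+
  ultimately have "lookup ?l (upper_right c) = 1" "lookup ?r (upper_right c) = 0"
    by (simp_all add: lookup_add in_keys_iff)
  then show False using eq by simp
qed

text \<open>Each coordinate of \<open>toric D'\<close> is cell-additive for \<open>D\<close>, so
  monomials of equal weight for \<open>D\<close> have equal weight for \<open>D'\<close>, and their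
  differences span the kernel.\<close>

lemma toric_ideal_mono:
  assumes "D \<subseteq> D'"
  shows "toric_ideal V D \<subseteq> toric_ideal V D'"
proof
  fix p :: "'a polynomial" assume p: "p \<in> toric_ideal V D"
  show "p \<in> toric_ideal V D'"
  proof (rule laurent_kernel_in_ideal[OF ideal_toric_ideal])
    show "p \<in> carrier (poly_ring V)" "laurent (toric D) p = 0" using p by (auto simp: toric_ideal_def)
    fix u v assume uv: "u \<in> monomials V" "v \<in> monomials V" "weight (toric D) u = weight (toric D) v"
    have "weight (toric D') u = weight (toric D') v"
    proof (rule poly_mapping_eqI)
      fix t
      have "cell_additive D (\<lambda>v. lookup (toric D' v) t)"
        using cell_additive_mono[OF cell_additive_toric assms]
        unfolding cell_additive_def by (metis lookup_add)
      from grading_eq_of_weight_eq[OF this uv(3)]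
      show "lookup (weight (toric D') u) t = lookup (weight (toric D') v) t"
        by (simp add: lookup_weight)
    qed
    then show "single u 1 - single v 1 \<in> toric_ideal V D'"
      using uv by (auto simp: toric_ideal_def laurent_diff monomials_def)
  qed
qed

section \<open>The polyomino ideal is toric\<close>

definition corner_closed :: "cells \<Rightarrow> bool" where
  "corner_closed P \<longleftrightarrow> (\<forall>x y. (x, Suc y) \<in> P \<longrightarrow> (Suc x, y) \<in> P \<longrightarrow> (x, y) \<in> P)"

lemma corner_closedD: "corner_closed P \<Longrightarrow> (x, Suc y) \<in> P \<Longrightarrow> (Suc x, y) \<in> P \<Longrightarrow> (x, y) \<in> P"
  by (auto simp: corner_closed_def)

section \<open>Vertices of cells and inner intervals\<close>

lemma mem_cell_iff: "v \<in> cell c \<longleftrightarrow> fst v \<in> {fst c, Suc (fst c)} \<and> snd v \<in> {snd c, Suc (snd c)}"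
  by (cases v) (auto simp: cell_def interval_def upper_right_def)

lemma vertices_of_cell:
  assumes "(x, y) \<in> P"
  shows "(x, y) \<in> vertices P" "(Suc x, y) \<in> vertices P" "(x, Suc y) \<in> vertices P" "(Suc x, Suc y) \<in> vertices P"
  using assms by (auto simp: vertices_def mem_cell_iff intro!: bexI[of _ "(x, y)"])

lemma inner_intervalI:
  assumes "i < k" "j < l" and P: "\<And>x y. i \<le> x \<Longrightarrow> x < k \<Longrightarrow> j \<le> y \<Longrightarrow> y < l \<Longrightarrow> (x, y) \<in> P"
  shows "inner_interval P (i, j) (k, l)"
  unfolding inner_interval_def
proof (intro conjI allI impI)
  show "proper_interval (i, j) (k, l)" using assms by (simp add: proper_interval_def)
  show "(i, j) \<in> vertices P" using vertices_of_cell(1)[of i j P] P assms by simp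
  show "(k, l) \<in> vertices P" using vertices_of_cell(4)[of "k - 1" "l - 1" P] P assms by simp
  fix c assume c: "cell c \<subseteq> interval (i, j) (k, l)"
  have "c \<in> cell c" "upper_right c \<in> cell c" by (simp_all add: mem_cell_iff upper_right_def)
  then have "c \<in> interval (i, j) (k, l)" "upper_right c \<in> interval (i, j) (k, l)" using c by auto
  then show "c \<in> P" using P[of "fst c" "snd c"] by (auto simp: interval_def upper_right_def)
qed

lemma inner_intervalD:
  assumes "inner_interval P (i, j) (k, l)"
  shows "i < k" "j < l" "\<And>x y. i \<le> x \<Longrightarrow> x < k \<Longrightarrow> j \<le> y \<Longrightarrow> y < l \<Longrightarrow> (x, y) \<in> P"
proof -
  show "i < k" "j < l" using assms by (auto simp: inner_interval_def proper_interval_def)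
  fix x y assume "i \<le> x" "x < k" "j \<le> y" "y < l"
  then have "cell (x, y) \<subseteq> interval (i, j) (k, l)" by (auto simp: mem_cell_iff interval_def)
  then show "(x, y) \<in> P" using assms by (auto simp: inner_interval_def)
qed

lemma interval_vertices:
  assumes "i < k" "j < l" and P: "\<And>x y. i \<le> x \<Longrightarrow> x < k \<Longrightarrow> j \<le> y \<Longrightarrow> y < l \<Longrightarrow> (x, y) \<in> P"
  shows "{i..k} \<times> {j..l} \<subseteq> vertices P"
proof clarify
  fix x y assume "x \<in> {i..k}" "y \<in> {j..l}"
  \<comment> \<open>Clamping to \<open>k - 1\<close> and \<open>l - 1\<close> selects a cell of the
    interval that has \<open>(x, y)\<close> as a vertex.\<close>
  moreover define x' y' where "x' = min x (k - 1)" and "y' = min y (l - 1)"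
  ultimately have "(x', y') \<in> P" "x = x' \<or> x = Suc x'" "y = y' \<or> y = Suc y'"
    using P[of x' y'] assms(1,2) by (auto simp: min_def)
  then show "(x, y) \<in> vertices P" using vertices_of_cell[of x' y' P] by auto
qed

lemma grading_indicator:
  assumes "finite H"
  shows "grading (\<lambda>v. if v \<in> H then 1 else 0) u = (\<Sum>v\<in>H. int (lookup u v))"
proof -
  have "grading (\<lambda>v. if v \<in> H then 1 else 0) u = (\<Sum>v\<in>keys u \<inter> H. int (lookup u v))"
    unfolding grading_def by (simp add: sum.inter_restrict if_distrib cong: if_cong)
  also have "\<dots> = (\<Sum>v\<in>H. int (lookup u v))"
    using assms by (intro sum.mono_neutral_left) (auto simp: in_keys_iff)
  finally show ?thesis .
qed

text \<open>The total exponent on \<open>H\<close> agrees for \<open>u\<close> and \<open>v\<close>.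
  If \<open>v\<close> involved no vertex of \<open>H\<close> other than \<open>z\<close>, its total
  would be smaller than that of \<open>u\<close>.\<close>

lemma exists_vertex_in_segment:
  assumes "finite H" "z \<in> H" "cell_additive P (\<lambda>v. if v \<in> H then 1 else 0 :: int)"
    and "weight (toric P) u = weight (toric P) v" "lookup v z < lookup u z"
  shows "\<exists>h\<in>H - {z}. 0 < lookup v h"
proof (rule ccontr)
  assume "\<not> ?thesis"
  then have "(\<Sum>w\<in>H. int (lookup v w)) = int (lookup v z)"
    using assms(1,2) by (simp add: sum.remove[of H z])
  moreover have "int (lookup u z) \<le> (\<Sum>w\<in>H. int (lookup u w))"
    using assms(1,2) by (intro member_le_sum) auto
  moreover have "(\<Sum>w\<in>H. int (lookup u w)) = (\<Sum>w\<in>H. int (lookup v w))"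
    using grading_eq_of_weight_eq[OF assms(3,4)] by (simp add: grading_indicator assms(1))
  ultimately show False using assms(5) by simp
qed

lemma cell_additiveI:
  "(\<And>x y. (x, y) \<in> D \<Longrightarrow> \<psi> (x, y) + \<psi> (Suc x, Suc y) = \<psi> (x, Suc y) + \<psi> (Suc x, y)) \<Longrightarrow>
    cell_additive D \<psi>"
  by (auto simp: cell_additive_def upper_right_def upper_left_def lower_right_def)

text \<open>This finds the start of the maximal run of \<open>Q\<close> ending at \<open>n\<close>.
  The boundary condition is stated through \<open>Suc i = m\<close>, so that it is void for
  \<open>m = 0\<close>.\<close>

lemma ex_least_run:
  assumes "Q (n :: nat)"
  shows "\<exists>m\<le>n. (\<forall>i. m \<le> i \<and> i \<le> n \<longrightarrow> Q i) \<and> (\<forall>i. Suc i = m \<longrightarrow> \<not> Q i)"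
proof -
  define R where "R m \<longleftrightarrow> m \<le> n \<and> (\<forall>i. m \<le> i \<and> i \<le> n \<longrightarrow> Q i)" for m
  define m where "m = (LEAST m. R m)"
  have "R n" using assms by (auto simp: R_def dest: le_antisym)
  then have Rm: "R m" unfolding m_def by (rule LeastI)
  moreover have "\<not> Q i" if "Suc i = m" for i
  proof
    assume "Q i"
    then have "R i" using Rm that unfolding R_def by (metis Suc_le_eq Suc_leD le_neq_implies_less)
    then have "m \<le> i" unfolding m_def by (rule Least_le)
    then show False using that by simp
  qed
  ultimately show ?thesis unfolding R_def by blast
qed

text \<open>By the two bounds, \<open>(a + 1, b + 1)\<close> is a vertex of no cell of
  \<open>P\<close> except possibly \<open>(a, b)\<close>, so the recursion meets it only when
  started there.\<close>

lemma toric_diff_upper_right: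
  assumes top: "\<And>x y. (x, y) \<in> P \<Longrightarrow> y \<le> b" and right: "\<And>x. (x, b) \<in> P \<Longrightarrow> x \<le> a"
    and "w \<noteq> (Suc a, Suc b)"
  shows "toric (P - {(a, b)}) w = toric P w"
  using assms
proof (induction P w rule: toric.induct)
  case (1 P x y)
  show ?case
  proof (cases "(x, y) \<in> P")
    case True
    have "(x, Suc y) \<noteq> (Suc a, Suc b)" "(Suc x, y) \<noteq> (Suc a, Suc b)" "(x, y) \<noteq> (Suc a, Suc b)"
      using 1(4)[OF True] 1(5)[of x] True by auto
    then show ?thesis using 1 True by auto
  qed auto
qed auto

text \<open>Changing the degree of \<open>z\<close> alone adds the exponent of \<open>z\<close>
  times the change, which is the same for both monomials.\<close>

lemma weight_eq_of_agree:
  assumes "weight \<sigma> u = weight \<sigma> v" "\<And>w. w \<noteq> z \<Longrightarrow> \<sigma>' w = \<sigma> w" "lookup u z = lookup v z"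
  shows "weight \<sigma>' u = weight \<sigma>' v"
proof -
  have "weight \<sigma>' u = weight \<sigma> u + frag_cmul (int (lookup u z)) (\<sigma>' z - \<sigma> z)" for u
  proof -
    have "weight \<sigma>' u - weight \<sigma> u = (\<Sum>w\<in>keys u. frag_cmul (int (lookup u w)) (\<sigma>' w) - frag_cmul (int (lookup u w)) (\<sigma> w))"
      by (simp add: weight_def sum_subtractf)
    also have "\<dots> = (\<Sum>w\<in>keys u. if w = z then frag_cmul (int (lookup u z)) (\<sigma>' z - \<sigma> z) else 0)"
      using assms(2) frag_cmul_distrib2[of _ "\<sigma>' z - \<sigma> z" "\<sigma> z"]
      by (intro sum.cong) (auto simp: algebra_simps)
    also have "\<dots> = frag_cmul (int (lookup u z)) (\<sigma>' z - \<sigma> z)"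
      by (simp add: in_keys_iff)
    finally show ?thesis by (simp add: algebra_simps)
  qed
  then show ?thesis using assms(1,3) by simp
qed

text \<open>Let \<open>c\<close> be the right-most cell in the top row and \<open>z\<close> its upper-right vertex.  Corner
  closedness makes the maximal horizontal and vertical edge segments through \<open>z\<close> the top and right
  side of an inner interval.  As the two segments are preserved by the grading, a monomial with
  too small an exponent of \<open>z\<close> contains an antidiagonal pair of an inner interval with corner \<open>z\<close>.\<close>
lemma toric_binomial_in_ideal:
  assumes "finite P" "corner_closed P" and J: "ideal J (poly_ring V)" and "vertices P \<subseteq> V"
    and "\<And>a b. inner_interval P a b \<Longrightarrow> (minor a b :: 'k::field polynomial) \<in> J"
    and "u \<in> monomials V" "v \<in> monomials V" "weight (toric P) u = weight (toric P) v"
  shows "single u 1 - single v 1 \<in> J"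
  using assms(1,2,4-)
proof (induction "card P" arbitrary: P u v)
  case 0
  then have P: "P = {}" by simp
  have "u = v"
  proof (rule poly_mapping_eqI)
    fix t
    \<comment> \<open>Without cells every indicator function is additive, so the weight determines
      each exponent.\<close>
    have "cell_additive P (\<lambda>v. if v \<in> {t} then 1 else 0 :: int)" by (simp add: P cell_additive_def)
    from grading_eq_of_weight_eq[OF this 0(8)]
    show "lookup u t = lookup v t" unfolding grading_indicator[OF finite.insertI[OF finite.emptyI]] by simp
  qed
  then show ?case using ideal_poly_ringD(2)[OF J] by simp
next
  case (Suc n)
  note fin = Suc(3) and cc = Suc(4) and PV = Suc(5) and inner = Suc(6)
  have ne: "P \<noteq> {}" using Suc(2) by auto
  define b where "b = Max (snd ` P)"
  define a where "a = Max {x. (x, b) \<in> P}"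
  have top: "y \<le> b" if "(x, y) \<in> P" for x y
    unfolding b_def using fin that by (intro Max_ge) force+
  have finr: "finite {x. (x, b) \<in> P}"
    by (rule finite_subset[of _ "fst ` P"]) (use fin in force)+
  have right: "x \<le> a" if "(x, b) \<in> P" for x
    unfolding a_def using finr that by (intro Max_ge) auto
  have "b \<in> snd ` P" unfolding b_def using fin ne by (intro Max_in) auto
  then have "{x. (x, b) \<in> P} \<noteq> {}" by auto
  then have cP: "(a, b) \<in> P" using Max_in[OF finr] by (simp add: a_def)
  define z where "z = (Suc a, Suc b)"
  \<comment> \<open>From \<open>(a, b)\<close> the row is followed to the left and the column
    downwards, up to the first gap.\<close>
  obtain x0 where x0: "x0 \<le> a" "\<And>x. x0 \<le> x \<Longrightarrow> x \<le> a \<Longrightarrow> (x, b) \<in> P" "\<And>x. Suc x = x0 \<Longrightarrow> (x, b) \<notin> P"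
    using ex_least_run[of "\<lambda>x. (x, b) \<in> P", OF cP] by blast
  obtain d where d: "d \<le> b" "\<And>y. d \<le> y \<Longrightarrow> y \<le> b \<Longrightarrow> (a, y) \<in> P" "\<And>y. Suc y = d \<Longrightarrow> (a, y) \<notin> P"
    using ex_least_run[of "\<lambda>y. (a, y) \<in> P", OF cP] by blast
  \<comment> \<open>Corner closedness fills the rectangle spanned by the two runs, moving away from
    \<open>(a, b)\<close>.\<close>
  have rect: "(x, y) \<in> P" if "x0 \<le> x" "x \<le> a" "d \<le> y" "y \<le> b" for x y
    using that
  proof (induction "(a - x) + (b - y)" arbitrary: x y rule: less_induct)
    case less
    show ?case
    proof (cases "x = a \<or> y = b")
      case False
      then have "(x, Suc y) \<in> P" "(Suc x, y) \<in> P"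
        using less.hyps[of x "Suc y"] less.hyps[of "Suc x" y] less.prems by auto
      then show ?thesis using corner_closedD[OF cc] by blast
    qed (use less.prems x0 d in auto)
  qed
  define H where "H = {x0..Suc a} \<times> {Suc b}"
  define E where "E = {Suc a} \<times> {d..Suc b}"
  have H: "cell_additive P (\<lambda>v. if v \<in> H then 1 else 0 :: int)"
  proof (rule cell_additiveI)
    fix x y assume xy: "(x, y) \<in> P"
    \<comment> \<open>The cell left of the run would meet \<open>H\<close> in a single vertex; it is
      missing by maximality.\<close>
    have "\<not> (y = b \<and> Suc x = x0)" using x0(3)[of x] xy by auto
    then show "(if (x, y) \<in> H then 1 else 0 :: int) + (if (Suc x, Suc y) \<in> H then 1 else 0) =
      (if (x, Suc y) \<in> H then 1 else 0) + (if (Suc x, y) \<in> H then 1 else 0)"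
      using top[OF xy] right[of x] xy by (auto simp: H_def)
  qed
  have E: "cell_additive P (\<lambda>v. if v \<in> E then 1 else 0 :: int)"
  proof (rule cell_additiveI)
    fix x y assume xy: "(x, y) \<in> P"
    have "\<not> (x = a \<and> Suc y = d)" using d(3)[of y] xy by auto
    \<comment> \<open>A cell at \<open>(a + 1, d - 1)\<close> would meet \<open>E\<close> only in
      its upper-left vertex. Together with \<open>(a, d)\<close> it would force
      \<open>(a, d - 1)\<close> into \<open>P\<close>, against the choice of
      \<open>d\<close>.\<close>
    moreover have "\<not> (x = Suc a \<and> Suc y = d)"
      using d(3)[of y] d(2)[of d] d(1) corner_closedD[OF cc, of a y] xy by auto
    ultimately show "(if (x, y) \<in> E then 1 else 0 :: int) + (if (Suc x, Suc y) \<in> E then 1 else 0) =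
      (if (x, Suc y) \<in> E then 1 else 0) + (if (Suc x, y) \<in> E then 1 else 0)"
      using top[OF xy] by (auto simp: E_def)
  qed
  \<comment> \<open>By symmetry the exponent of \<open>z\<close> in \<open>v\<close> may be assumed
    not to exceed that in \<open>u\<close>; the induction is on the gap.\<close>
  have main: "single u 1 - single v 1 \<in> J"
    if "u \<in> monomials V" "v \<in> monomials V" "weight (toric P) u = weight (toric P) v"
      "lookup v z \<le> lookup u z" for u v
    using that
  proof (induction "lookup u z - lookup v z" arbitrary: v)
    case 0
    \<comment> \<open>With equal exponents of \<open>z\<close>, deleting the cell below
      \<open>z\<close> preserves the equality of weights, and the outer induction applies.\<close>
    define P' where "P' = P - {(a, b)}"
    have "corner_closed P'"
      unfolding corner_closed_def
    proof (intro allI impI)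
      fix x y assume xy: "(x, Suc y) \<in> P'" "(Suc x, y) \<in> P'"
      then have "(x, y) \<in> P" using corner_closedD[OF cc, of x y] by (auto simp: P'_def)
      moreover have "(x, y) \<noteq> (a, b)" using xy top[of x "Suc y"] by (auto simp: P'_def)
      ultimately show "(x, y) \<in> P'" by (simp add: P'_def)
    qed
    moreover have "vertices P' \<subseteq> vertices P" by (auto simp: vertices_def P'_def)
    moreover have "inner_interval P p q" if "inner_interval P' p q" for p q
      using that \<open>vertices P' \<subseteq> vertices P\<close> unfolding inner_interval_def by (auto simp: P'_def)
    moreover have "weight (toric P') u = weight (toric P') v"
    proof (rule weight_eq_of_agree[OF 0(4)])
      show "lookup u z = lookup v z" using 0 by simp
      show "toric P' w = toric P w" if "w \<noteq> z" for w
        unfolding P'_def using top right that by (intro toric_diff_upper_right) (auto simp: z_def)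
    qed
    moreover have "n = card P'" using Suc(2) cP fin by (simp add: P'_def)
    ultimately show ?case
      using Suc(1)[of P' u v] fin PV inner 0 by (simp add: P'_def subset_trans)
  next
    case (Suc m)
    have lt: "lookup v z < lookup u z" using Suc(2) by simp
    obtain x where x: "x0 \<le> x" "x \<le> a" "0 < lookup v (x, Suc b)"
      using exists_vertex_in_segment[OF _ _ H Suc(5) lt] x0(1) by (auto simp: H_def z_def le_Suc_eq)
    obtain y where y: "d \<le> y" "y \<le> b" "0 < lookup v (Suc a, y)"
      using exists_vertex_in_segment[OF _ _ E Suc(5) lt] d(1) by (auto simp: E_def z_def le_Suc_eq)
    \<comment> \<open>\<open>v1\<close> arises from \<open>v\<close> by trading the antidiagonal
      pair \<open>(x, b + 1)\<close>, \<open>(a + 1, y)\<close> for the diagonal pair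
      \<open>(x, y)\<close>, \<open>z\<close>; this raises the exponent of \<open>z\<close> by
      one.\<close>
    define v0 where "v0 = v - single (x, Suc b) 1 - single (Suc a, y) 1"
    define v1 where "v1 = v0 + single (x, y) 1 + single z 1"
    have v: "v = v0 + single (x, Suc b) 1 + single (Suc a, y) 1"
      using x y by (intro poly_mapping_eqI) (auto simp: v0_def lookup_add lookup_minus lookup_single when_def)
    have cells: "(x', y') \<in> P" if "x \<le> x'" "x' < Suc a" "y \<le> y'" "y' < Suc b" for x' y'
      using rect[of x' y'] that x y by simp
    have V: "{x..Suc a} \<times> {y..Suc b} \<subseteq> V"
      using interval_vertices[of x "Suc a" y "Suc b" P] cells PV x(2) y(2) by force
    have "inner_interval P (x, y) z" unfolding z_def
      using x y cells by (intro inner_intervalI) auto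
    then have mJ: "(minor (x, y) z :: 'k polynomial) \<in> J" by (rule inner)
    have v0V: "keys v0 \<subseteq> V"
      using Suc(4) by (auto simp: v0_def monomials_def in_keys_iff lookup_minus)
    have "single v1 1 - single v 1 = single v0 1 * (minor (x, y) z :: 'k polynomial)"
      unfolding v by (simp add: minor_def indet_def v1_def mult_single right_diff_distrib z_def add.assoc)
    also have "\<dots> \<in> J" using v0V mJ by (intro ideal_poly_ringD(4)[OF J] poly_ring_single)
    finally have 1: "single v1 1 - (single v 1 :: 'k polynomial) \<in> J" .
    have "minor (x, y) z \<in> (toric_ideal V P :: 'k polynomial set)"
      unfolding z_def
    proof (rule minor_in_saturated[OF saturated_toric_ideal])
      fix x' y' assume "x \<le> x'" "x' < Suc a" "y \<le> y'" "y' < Suc b"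
      then show "cell_minor (x', y') \<in> toric_ideal V P"
        using cells[of x' y'] PV by (intro cell_minor_in_toric_ideal) (auto simp: vertices_def)
    qed (use x y V in auto)
    then have "toric P (x, y) + toric P z = toric P (x, Suc b) + toric P (Suc a, y)"
      by (simp add: toric_ideal_def laurent_minor single_one_inject z_def)
    then have "weight (toric P) v1 = weight (toric P) v"
      by (simp add: v v1_def weight_add add.assoc)
    moreover have "v1 \<in> monomials V"
    proof -
      have "keys v1 \<subseteq> keys v0 \<union> {(x, y), z}"
        unfolding v1_def by (auto simp: in_keys_iff lookup_add lookup_single when_def split: if_splits)
      moreover have "{(x, y), z} \<subseteq> {x..Suc a} \<times> {y..Suc b}" using x y by (auto simp: z_def)
      ultimately show ?thesis using v0V V unfolding monomials_def by blast
    qed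
    moreover have "lookup v1 z = Suc (lookup v z)"
      using x y by (simp add: v v1_def lookup_add lookup_single z_def)
    ultimately have 2: "single u 1 - (single v1 1 :: 'k polynomial) \<in> J"
      using Suc by (intro Suc(1)) auto
    show ?case using ideal_poly_ringD(3)[OF J 2 1] by simp
  qed
  show ?case
  proof (cases "lookup v z \<le> lookup u z")
    case False
    then have "single v 1 - (single u 1 :: 'k polynomial) \<in> J" using Suc by (intro main) auto
    then show ?thesis using ideal_poly_ringD(6)[OF J] by fastforce
  qed (use Suc main in auto)
qed

lemma polyomino_ideal_eq:
  "polyomino_ideal P = Idl\<^bsub>poly_ring (vertices P)\<^esub> {minor a b | a b. inner_interval P a b}"
  by (simp add: polyomino_ideal_def minor_def)

lemma toric_ideal_eq:
  assumes "finite P" "corner_closed P"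
  shows "toric_ideal (vertices P) P = (polyomino_ideal P :: 'k::field polynomial set)"
proof -
  let ?V = "vertices P"
  interpret ring "poly_ring ?V :: 'k polynomial ring" by (rule ring_poly_ring)
  let ?G = "{minor a b | a b. inner_interval P a b} :: 'k polynomial set"
  note G = polyomino_ideal_eq
  have GT: "?G \<subseteq> toric_ideal ?V P"
  proof clarify
    fix i j k l assume ij: "inner_interval P (i, j) (k, l)"
    note D = inner_intervalD[OF ij]
    show "minor (i, j) (k, l) \<in> toric_ideal ?V P"
    proof (rule minor_in_saturated[OF saturated_toric_ideal D(1,2)])
      show "{i..k} \<times> {j..l} \<subseteq> ?V" by (rule interval_vertices[OF D])
      fix x y assume "i \<le> x" "x < k" "j \<le> y" "y < l"
      then show "cell_minor (x, y) \<in> toric_ideal ?V P"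
        using D(3)[of x y] by (intro cell_minor_in_toric_ideal) (auto simp: vertices_def)
    qed
  qed
  then have GS: "?G \<subseteq> carrier (poly_ring ?V)" using ideal_poly_ringD(1)[OF ideal_toric_ideal] by blast
  have I: "ideal (polyomino_ideal P :: 'k polynomial set) (poly_ring ?V)"
    unfolding G using GS by (rule genideal_ideal)
  have GI: "minor a b \<in> (polyomino_ideal P :: 'k polynomial set)" if "inner_interval P a b" for a b
    unfolding G using genideal_self[OF GS] that by blast
  have "(polyomino_ideal P :: 'k polynomial set) \<subseteq> toric_ideal ?V P"
    unfolding G using GT by (rule genideal_minimal[OF ideal_toric_ideal])
  moreover have "p \<in> polyomino_ideal P" if p: "p \<in> toric_ideal ?V P" for p :: "'k polynomial"
  proof (rule laurent_kernel_in_ideal[OF I])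
    show "p \<in> carrier (poly_ring ?V)" "laurent (toric P) p = 0"
      using p by (simp_all add: toric_ideal_def)
    fix u v assume "u \<in> monomials ?V" "v \<in> monomials ?V" "weight (toric P) u = weight (toric P) v"
    then show "single u 1 - single v 1 \<in> (polyomino_ideal P :: 'k polynomial set)"
      by (intro toric_binomial_in_ideal[OF assms I order_refl] GI)
  qed
  ultimately show ?thesis by blast
qed

section \<open>Parallelogram polyominoes with ladders\<close>

lemma edge_adjacent_cases:
  assumes "edge_adjacent c d"
  shows "fst d = fst c \<and> snd d \<le> Suc (snd c) \<or> snd d = snd c \<and> fst d \<le> Suc (fst c)"
proof -
  have "cell c \<inter> cell d \<in> cell_edges c" using assms by (simp add: edge_adjacent_def)
  then consider "c \<in> cell d" "lower_right c \<in> cell d" | "c \<in> cell d" "upper_left c \<in> cell d"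
    | "lower_right c \<in> cell d" "upper_right c \<in> cell d" | "upper_left c \<in> cell d" "upper_right c \<in> cell d"
    unfolding cell_edges_def by (elim insertE; blast)
  then show ?thesis
    by cases (auto simp: mem_cell_iff upper_left_def upper_right_def lower_right_def)
qed

lemma polyomino_connected_induct:
  assumes "polyomino P" "c \<in> P" "U c" "d \<in> P"
    and step: "\<And>c d. c \<in> P \<Longrightarrow> d \<in> P \<Longrightarrow> U c \<Longrightarrow> edge_adjacent c d \<Longrightarrow> U d"
  shows "U d"
proof -
  obtain cs where cs: "cs \<noteq> []" "hd cs = c" "last cs = d" "set cs \<subseteq> P"
    "\<And>i. Suc i < length cs \<Longrightarrow> edge_adjacent (cs ! i) (cs ! Suc i)"
    using assms(1,2,4) unfolding polyomino_def by blast
  have "U (cs ! i)" if "i < length cs" for i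
    using that
  proof (induction i)
    case 0
    then show ?case using cs(1,2) assms(3) by (simp add: hd_conv_nth)
  next
    case (Suc i)
    then show ?case using cs(4) by (intro step[OF _ _ _ cs(5)]) auto
  qed
  from this[of "length cs - 1"] show ?thesis using cs(1,3) by (simp add: last_conv_nth)
qed

text \<open>If \<open>(a, b)\<close> is missing, convexity keeps \<open>Q\<close> out of column
  \<open>a\<close> up to row \<open>b\<close> and out of row \<open>b\<close> up to column
  \<open>a\<close>. The lattice property makes \<open>(a, b)\<close> a vertex, so there is a cell
  strictly to the lower left, which no path in \<open>Q\<close> can connect to
  \<open>(a + 1, b)\<close>.\<close>

lemma parallelogram_corner_closed:
  assumes Q: "parallelogram_polyomino Q"
  shows "corner_closed Q"
  unfolding corner_closed_def
proof (intro allI impI)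
  fix a b assume X: "(a, Suc b) \<in> Q" and Y: "(Suc a, b) \<in> Q"
  have poly: "polyomino Q" and lat: "sublattice (vertices Q)"
    using Q by (auto simp: parallelogram_polyomino_def)
  have hc: "(l, j) \<in> Q" if "(i, j) \<in> Q" "(k, j) \<in> Q" "i \<le> l" "l \<le> k" for i j k l
  proof (cases "i < k")
    case True
    have "horizontally_convex Q" using Q by (simp add: parallelogram_polyomino_def)
    then show ?thesis using that True unfolding horizontally_convex_def by (metis atLeastAtMost_iff)
  next
    case False
    then have "l = i" using that by simp
    then show ?thesis using that by simp
  qed
  have vc: "(i, l) \<in> Q" if "(i, j) \<in> Q" "(i, k) \<in> Q" "j \<le> l" "l \<le> k" for i j k l
  proof (cases "j < k")
    case True
    have "vertically_convex Q" using Q by (simp add: parallelogram_polyomino_def)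
    then show ?thesis using that True unfolding vertically_convex_def by (metis atLeastAtMost_iff)
  next
    case False
    then have "l = j" using that by simp
    then show ?thesis using that by simp
  qed
  show "(a, b) \<in> Q"
  proof (rule ccontr)
    assume n: "(a, b) \<notin> Q"
    have "(a, Suc b) \<in> vertices Q" "(Suc a, b) \<in> vertices Q"
      using vertices_of_cell[OF X] vertices_of_cell[OF Y] by auto
    then have "(min a (Suc a), min (Suc b) b) \<in> vertices Q"
      using lat unfolding sublattice_def by force
    then obtain c where c: "c \<in> Q" "(a, b) \<in> cell c" by (auto simp: vertices_def min_def)
    define U where "U c \<longleftrightarrow> fst c < a \<and> snd c < b" for c :: vertex
    have col: "(a, y) \<notin> Q" if "y \<le> b" for y using vc[of a y "Suc b" b] that X n by auto
    have row: "(x, b) \<notin> Q" if "x \<le> a" for x using hc[of x b "Suc a" a] that Y n by auto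
    have "U c"
      using c col[of "snd c"] row[of "fst c"] by (cases c) (auto simp: U_def mem_cell_iff)
    then have "U (Suc a, b)"
    proof (rule polyomino_connected_induct[OF poly c(1) _ Y])
      fix c d assume cd: "c \<in> Q" "d \<in> Q" "U c" "edge_adjacent c d"
      have "\<not> (fst d = a \<and> snd d \<le> b)" "\<not> (snd d = b \<and> fst d \<le> a)"
        using col[of "snd d"] row[of "fst d"] cd(2) by (cases d; auto)+
      then show "U d"
        using edge_adjacent_cases[OF cd(4)] cd(3) unfolding U_def by arith
    qed
    then show False by (simp add: U_def)
  qed
qed

section \<open>Ladders and the segment on which they stand\<close>

lemma leftmost_list_hd_le:
  assumes "leftmost_list R as" "v \<in> vertices R"
  shows "as \<noteq> []" "snd (hd as) \<le> snd v"
proof -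
  obtain a where a: "a \<in> set as" "snd a = snd v" using assms unfolding leftmost_list_def by metis
  then show "as \<noteq> []" by auto
  then show "snd (hd as) \<le> snd v"
    using assms(1) a by (cases as) (auto simp: leftmost_list_def)
qed

lemma leftmost_list_eq_hd:
  assumes "leftmost_list R as" "a \<in> set as" "snd a = snd (hd as)"
  shows "a = hd as"
  using assms by (cases as) (auto simp: leftmost_list_def)

text \<open>The left-most vertex at height \<open>b + 1\<close> is not the first one, so it is the
  upper-left vertex of a cell in row \<open>b\<close>. Horizontal convexity joins this cell to
  \<open>(a + 1, b)\<close> through \<open>(a, b)\<close>.\<close>

lemma ladder_corner:
  assumes R: "ladder_polyomino R" and X: "(a, Suc b) \<in> R" and Y: "(Suc a, b) \<in> R"
  shows "(a, b) \<in> R"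
proof -
  obtain as where as: "leftmost_list R as"
    "\<And>i. 1 \<le> i \<Longrightarrow> i < length as \<Longrightarrow> \<exists>c\<in>R. as ! i = upper_left c"
    using R unfolding ladder_polyomino_def by blast
  have "(a, Suc b) \<in> vertices R" using vertices_of_cell[OF X] by simp
  then obtain l where l: "l \<in> set as" "snd l = Suc b" "fst l \<le> a"
    using as(1) unfolding leftmost_list_def by (metis fst_conv less_imp_le order_refl snd_conv)
  then obtain i where i: "i < length as" "as ! i = l" by (auto simp: in_set_conv_nth)
  have "snd (hd as) \<le> b" "as \<noteq> []"
    using leftmost_list_hd_le[OF as(1), of "(Suc a, b)"] vertices_of_cell[OF Y] by auto
  then have "i \<noteq> 0" using i l(2) by (intro notI) (simp add: hd_conv_nth)
  then obtain c where c: "c \<in> R" "l = upper_left c" using as(2)[of i] i by auto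
  then have "(fst l, b) \<in> R" using l(2) by (cases c) (auto simp: upper_left_def)
  moreover have "horizontally_convex R" using R by (simp add: ladder_polyomino_def)
  moreover have "fst l < Suc a" using l(3) by simp
  ultimately have "\<forall>x\<in>{fst l..Suc a}. (x, b) \<in> R"
    using Y unfolding horizontally_convex_def by blast
  then show ?thesis using l(3) by simp
qed

lemma finite_vertices: "finite P \<Longrightarrow> finite (vertices P)"
  by (auto simp: vertices_def cell_def interval_def)

lemma support_of_vertex:
  assumes "v \<in> vertices P" shows "(real (fst v), real (snd v)) \<in> support P"
proof -
  obtain c where c: "c \<in> P" "v \<in> cell c" using assms by (auto simp: vertices_def)
  then have "(real (fst v), real (snd v)) \<in> cell_support c"
    by (auto simp: mem_cell_iff cell_support_def)
  then show ?thesis using c by (auto simp: support_def)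
qed

text \<open>A common vertex lies in both supports, hence on the bottom segment of
  \<open>R\<close>.\<close>

lemma based_on_common_vertex:
  assumes "based_on R Q" "v \<in> vertices R" "v \<in> vertices Q" "w \<in> vertices R"
  shows "snd v \<le> snd w"
proof -
  obtain as b where as: "leftmost_list R as" and seg: "support R \<inter> support Q =
      closed_segment (real (fst (hd as)), real (snd (hd as))) (real b, real (snd (hd as)))"
    using assms(1) unfolding based_on_def Let_def by blast
  have "(real (fst v), real (snd v)) \<in> support R \<inter> support Q"
    using support_of_vertex assms by blast
  then have "snd v = snd (hd as)"
    unfolding seg closed_segment_def by (auto simp: algebra_simps)
  then show ?thesis using leftmost_list_hd_le(2)[OF as assms(4)] by simp
qed

text \<open>The midpoint of the lower edge of the cell \<open>(a, b + 1)\<close> lies in \<open>sp(Q)\<close>.\<close>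
lemma based_on_bottom_cell:
  assumes R: "based_on R Q" "finite R" and X: "(a, Suc b) \<in> R"
    and bottom: "\<And>w. w \<in> vertices R \<Longrightarrow> Suc b \<le> snd w"
  shows "(a, b) \<in> Q \<or> (a, Suc b) \<in> Q"
proof -
  obtain as where as: "leftmost_list R as" and seg: "support R \<inter> support Q =
      closed_segment (real (fst (hd as)), real (snd (hd as)))
        (real (Max {v. (v, snd (hd as)) \<in> vertices R}), real (snd (hd as)))"
    using R(1) unfolding based_on_def Let_def by blast
  note V = vertices_of_cell[OF X]
  have "as \<noteq> []" and hdle: "snd (hd as) \<le> Suc b" using leftmost_list_hd_le[OF as V(1)] by auto
  then have "hd as \<in> vertices R" using as unfolding leftmost_list_def by auto
  then have lev: "snd (hd as) = Suc b" using bottom[of "hd as"] hdle by simp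
  have left: "fst (hd as) \<le> a"
  proof -
    obtain l where "l \<in> set as" "snd l = Suc b" "fst l \<le> a"
      using as V(1) unfolding leftmost_list_def by (metis fst_conv less_imp_le order_refl snd_conv)
    then show ?thesis using leftmost_list_eq_hd[OF as, of l] lev by simp
  qed
  define m where "m = Max {v. (v, Suc b) \<in> vertices R}"
  have "finite {v. (v, Suc b) \<in> vertices R}"
    by (rule finite_subset[of _ "fst ` vertices R"]) (use finite_vertices[OF R(2)] in force)+
  then have right: "Suc a \<le> m" unfolding m_def using V(2) by (intro Max_ge) auto
  let ?p = "(real a + 1/2, real (Suc b))"
  \<comment> \<open>Parameter of the midpoint; it lies in \<open>[0, 1]\<close> because the segment
    covers the whole lower edge of the cell.\<close>
  define t where "t = (real a + 1/2 - real (fst (hd as))) / (real m - real (fst (hd as)))"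
  have pos: "0 < real m - real (fst (hd as))" using left right by simp
  have t: "0 \<le> t" "t \<le> 1" "t * (real m - real (fst (hd as))) = real a + 1/2 - real (fst (hd as))"
    using pos left right by (auto simp: t_def field_simps)
  have "?p = (1 - t) *\<^sub>R (real (fst (hd as)), real (Suc b)) + t *\<^sub>R (real m, real (Suc b))"
    using t(3) by (simp add: algebra_simps)
  then have "?p \<in> support R \<inter> support Q"
    unfolding seg lev m_def[symmetric] closed_segment_def using t by blast
  then obtain c where c: "c \<in> Q" "?p \<in> cell_support c" by (auto simp: support_def)
  \<comment> \<open>The abscissa \<open>a + 1/2\<close> is interior to column \<open>a\<close>, so
    only the cells directly above and below the edge contain the point.\<close>
  then have "fst c = a" "snd c = b \<or> snd c = Suc b" by (auto simp: cell_support_def)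
  then show ?thesis using c(1) by (cases c) auto
qed

text \<open>Two cells of one piece are handled by that piece. If the upper cell is in a ladder and
  the lower one in \<open>Q\<close>, the ladder stands on \<open>Q\<close> there. The opposite
  mixture and two different ladders are excluded by the common vertex
  \<open>(a + 1, b + 1)\<close>.\<close>

lemma parallelogram_ladders_corner_closed:
  assumes Q: "parallelogram_polyomino Q" and P: "P = Q \<union> (\<Union>i\<in>I. R i)"
    and ladder: "\<And>i. i \<in> I \<Longrightarrow> ladder_polyomino (R i)"
    and based: "\<And>i. i \<in> I \<Longrightarrow> based_on (R i) Q"
    and disj: "\<And>i j. i \<in> I \<Longrightarrow> j \<in> I \<Longrightarrow> i \<noteq> j \<Longrightarrow> vertices (R i) \<inter> vertices (R j) = {}"
  shows "corner_closed P"
  unfolding corner_closed_def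
proof (intro allI impI)
  fix a b assume X: "(a, Suc b) \<in> P" and Y: "(Suc a, b) \<in> P"
  note qq = corner_closedD[OF parallelogram_corner_closed[OF Q], of a b]
  consider "(a, Suc b) \<in> Q" "(Suc a, b) \<in> Q"
    | i where "i \<in> I" "(a, Suc b) \<in> R i" "(Suc a, b) \<in> Q"
    | i where "i \<in> I" "(a, Suc b) \<in> Q" "(Suc a, b) \<in> R i"
    | i j where "i \<in> I" "j \<in> I" "(a, Suc b) \<in> R i" "(Suc a, b) \<in> R j"
    using X Y P by blast
  then show "(a, b) \<in> P"
  proof cases
    case 1
    then show ?thesis using qq P by blast
  next
    case (2 i)
    have "Suc b \<le> snd w" if "w \<in> vertices (R i)" for w
      using based_on_common_vertex[OF based[OF 2(1)], of "(Suc a, Suc b)" w] that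
        vertices_of_cell[OF 2(2)] vertices_of_cell[OF 2(3)] by simp
    moreover have "finite (R i)" using ladder[OF 2(1)] by (simp add: ladder_polyomino_def polyomino_def)
    ultimately have "(a, b) \<in> Q \<or> (a, Suc b) \<in> Q"
      using based_on_bottom_cell[OF based[OF 2(1)] _ 2(2)] by blast
    then show ?thesis using qq 2 P by blast
  next
    case (3 i)
    then show ?thesis
      using based_on_common_vertex[OF based[OF 3(1)], of "(Suc a, Suc b)" "(Suc a, b)"]
        vertices_of_cell[OF 3(2)] vertices_of_cell[OF 3(3)] by simp
  next
    case (4 i j)
    have "i = j" using disj[OF 4(1,2)] vertices_of_cell[OF 4(3)] vertices_of_cell[OF 4(4)] by blast
    then show ?thesis using ladder_corner[OF ladder[OF 4(1)]] 4 P by blast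
  qed
qed

section \<open>Square-free initial monomials\<close>

text \<open>Small keys mean large variables: among the vertices with different exponents, the one
  with the smallest key decides.\<close>

definition lex_less :: "(vertex \<Rightarrow> 'a::linorder) \<Rightarrow> monomial \<Rightarrow> monomial \<Rightarrow> bool" where
  "lex_less g m n \<longleftrightarrow> (\<exists>v. lookup m v < lookup n v \<and> (\<forall>w. g w < g v \<longrightarrow> lookup m w = lookup n w))"

definition lex_order :: "(vertex \<Rightarrow> 'a::linorder) \<Rightarrow> vertex set \<Rightarrow> monomial rel" where
  "lex_order g V = {(m, n). m \<in> monomials V \<and> n \<in> monomials V \<and> (m = n \<or> lex_less g m n)}"

lemma lex_less_total:
  assumes "inj g" "m \<noteq> n" shows "lex_less g m n \<or> lex_less g n m"
proof -
  let ?D = "{v. lookup m v \<noteq> lookup n v}"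
  have fin: "finite ?D"
    by (rule finite_subset[of _ "keys m \<union> keys n"]) (auto simp: in_keys_iff)
  have "?D \<noteq> {}" using assms(2) by (auto intro: poly_mapping_eqI)
  then have "Min (g ` ?D) \<in> g ` ?D" using fin by (intro Min_in) auto
  then obtain v where v: "v \<in> ?D" "g v = Min (g ` ?D)" by auto
  have eq: "lookup m w = lookup n w" if "g w < g v" for w
  proof (rule ccontr)
    assume "lookup m w \<noteq> lookup n w"
    then have "Min (g ` ?D) \<le> g w" using fin by (intro Min_le) auto
    then show False using that v(2) by simp
  qed
  from v(1) have "lookup m v < lookup n v \<or> lookup n v < lookup m v" by auto
  then show ?thesis using eq unfolding lex_less_def by metis
qed

lemma lex_less_trans:
  assumes "inj g" "lex_less g m n" "lex_less g n p" shows "lex_less g m p"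
proof -
  obtain v where v: "lookup m v < lookup n v" "\<And>w. g w < g v \<Longrightarrow> lookup m w = lookup n w"
    using assms(2) by (auto simp: lex_less_def)
  obtain v' where v': "lookup n v' < lookup p v'" "\<And>w. g w < g v' \<Longrightarrow> lookup n w = lookup p w"
    using assms(3) by (auto simp: lex_less_def)
  consider "g v < g v'" | "v = v'" | "g v' < g v" using assms(1) by (metis injD neq_iff)
  then show ?thesis
  proof cases
    case 1
    then show ?thesis unfolding lex_less_def using v v' by (intro exI[of _ v]) auto
  next
    case 2
    then show ?thesis unfolding lex_less_def using v v' by (intro exI[of _ v]) auto
  next
    case 3
    then show ?thesis unfolding lex_less_def using v v' by (intro exI[of _ v']) auto
  qed
qed

lemma lex_less_irrefl: "\<not> lex_less g m m"
  by (simp add: lex_less_def)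

lemma lex_less_add: "lex_less g m n \<Longrightarrow> lex_less g (m + l) (n + l)"
  by (auto simp: lex_less_def lookup_add)

lemma monomials_add: "m \<in> monomials V \<Longrightarrow> n \<in> monomials V \<Longrightarrow> m + n \<in> monomials V"
  using Poly_Mapping.keys_add[of m n] by (auto simp: monomials_def)

lemma monomial_order_lex:
  assumes g: "inj g" shows "monomial_order V (lex_order g V)"
  unfolding monomial_order_def
proof (intro conjI ballI allI impI)
  show "linear_order_on (monomials V) (lex_order g V)"
    unfolding linear_order_on_def partial_order_on_def preorder_on_def refl_on_def total_on_def
  proof (intro conjI)
    show "trans (lex_order g V)"
      by (rule transI) (auto simp: lex_order_def intro: lex_less_trans[OF g])
    show "antisym (lex_order g V)"
      by (rule antisymI) (auto simp: lex_order_def dest: lex_less_trans[OF g] simp: lex_less_irrefl)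
  qed (use lex_less_total[OF g] in \<open>auto simp: lex_order_def\<close>)
next
  fix m assume m: "m \<in> monomials V"
  have "\<not> lex_less g m 0" by (simp add: lex_less_def)
  then show "(0, m) \<in> lex_order g V"
    using lex_less_total[OF g, of m 0] m by (auto simp: lex_order_def monomials_def)
next
  fix m n l assume "(m, n) \<in> lex_order g V" "l \<in> monomials V"
  then show "(m + l, n + l) \<in> lex_order g V"
    by (auto simp: lex_order_def monomials_add lex_less_add)
qed

text \<open>Only the two initial terms contribute to the exponent \<open>m + n\<close>, so its
  coefficient is the product of two nonzero coefficients.\<close>

lemma initial_monomial_mult:
  fixes p q :: "'k::field polynomial"
  assumes r: "monomial_order V r" and p: "initial_monomial r p m" and q: "initial_monomial r q n"
    and car: "p \<in> carrier (poly_ring V)" "q \<in> carrier (poly_ring V)"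
  shows "initial_monomial r (p * q) (m + n)"
proof -
  have lin: "linear_order_on (monomials V) r"
    and add: "\<And>a b l. (a, b) \<in> r \<Longrightarrow> l \<in> monomials V \<Longrightarrow> (a + l, b + l) \<in> r"
    using r by (auto simp: monomial_order_def)
  have trans: "\<And>a b c. (a, b) \<in> r \<Longrightarrow> (b, c) \<in> r \<Longrightarrow> (a, c) \<in> r"
    and anti: "\<And>a b. (a, b) \<in> r \<Longrightarrow> (b, a) \<in> r \<Longrightarrow> a = b"
    using lin by (auto simp: linear_order_on_def partial_order_on_def preorder_on_def
        dest: transD antisymD)
  have le: "(a + b, m + b) \<in> r" "(m + b, m + n) \<in> r" if "a \<in> keys p" "b \<in> keys q" for a b
  proof -
    have "a \<in> monomials V" "b \<in> monomials V" "m \<in> monomials V"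
      using car that p by (auto simp: in_poly_ring_iff monomials_def initial_monomial_def)
    moreover have "(a, m) \<in> r" "(b, n) \<in> r" using p q that by (auto simp: initial_monomial_def)
    ultimately show "(a + b, m + b) \<in> r" "(m + b, m + n) \<in> r"
      using add[of a m b] add[of b n m] by (auto simp: add.commute)
  qed
  have uniq: "a = m \<and> b = n" if ab: "a \<in> keys p" "b \<in> keys q" "a + b = m + n" for a b
  proof -
    have "m + b = m + n" using anti[of "m + b" "m + n"] le[OF ab(1,2)] ab(3) by simp
    then show ?thesis using ab(3) by simp
  qed
  define p' q' where "p' = p - single m (lookup p m)" and "q' = q - single n (lookup q n)"
  have k: "keys p' \<subseteq> keys p - {m}" "keys q' \<subseteq> keys q - {n}"
    by (auto simp: p'_def q'_def in_keys_iff lookup_minus lookup_single when_def split: if_splits)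
  have "m + n \<notin> keys (single m (lookup p m) * q')"
  proof
    assume "m + n \<in> keys (single m (lookup p m) * q')"
    then obtain b where "m + n = m + b" "b \<in> keys q'"
      using keys_mult[of "single m (lookup p m)" q'] by (auto split: if_splits)
    then show False using k by auto
  qed
  moreover have "m + n \<notin> keys (p' * q)"
  proof
    assume "m + n \<in> keys (p' * q)"
    then obtain a b where "m + n = a + b" "a \<in> keys p'" "b \<in> keys q" using keys_mult[of p' q] by blast
    then show False using uniq[of a b] k by auto
  qed
  moreover have "p * q = single (m + n) (lookup p m * lookup q n) + single m (lookup p m) * q' + p' * q"
    by (simp add: p'_def q'_def algebra_simps mult_single)
  ultimately have "lookup (p * q) (m + n) = lookup p m * lookup q n"
    by (simp add: lookup_add in_keys_iff)
  then have "m + n \<in> keys (p * q)" using p q by (simp add: initial_monomial_def in_keys_iff)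
  moreover have "(c, m + n) \<in> r" if c: "c \<in> keys (p * q)" for c
  proof -
    obtain a b where "c = a + b" "a \<in> keys p" "b \<in> keys q" using c keys_mult[of p q] by blast
    then show ?thesis using trans[OF le(1)[of a b] le(2)[of a b]] by simp
  qed
  ultimately show ?thesis by (simp add: initial_monomial_def)
qed

text \<open>The order on the vertices makes the antidiagonal term of \<open>det M\<^sub>k\<close> the largest one.\<close>
definition antidiagonal_key :: "vertex \<Rightarrow> int \<times> int" where
  "antidiagonal_key v = (int (fst v), - int (snd v))"

lemma inj_antidiagonal_key: "inj antidiagonal_key"
  by (simp add: inj_def antidiagonal_key_def prod_eq_iff)

lemma lookup_permutation_monomial:
  "lookup (\<Sum>k=0..<n. single (i + k, j + p k) 1 :: monomial) (x, y) =
     (if i \<le> x \<and> x < i + n \<and> y = j + p (x - i) then 1 else 0)"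
proof -
  have "lookup (\<Sum>k=0..<n. single (i + k, j + p k) 1 :: monomial) (x, y) =
    (\<Sum>k=0..<n. if k = x - i then (if i \<le> x \<and> y = j + p (x - i) then 1 else 0) else 0)"
    unfolding lookup_sum
  proof (rule sum.cong[OF refl])
    fix k
    have "i + k = x \<longleftrightarrow> i \<le> x \<and> k = x - i" by auto
    then show "lookup (single (i + k, j + p k) 1 :: monomial) (x, y) =
        (if k = x - i then (if i \<le> x \<and> y = j + p (x - i) then 1 else 0) else 0)"
      by (auto simp: lookup_single when_def)
  qed
  also have "\<dots> = (if x - i \<in> {0..<n} \<and> i \<le> x \<and> y = j + p (x - i) then 1 else 0)"
    by (simp add: sum.delta)
  finally show ?thesis by auto
qed

text \<open>Before the first row \<open>a\<close> in which \<open>p\<close> deviates, the columns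
  above \<open>n - 1 - a\<close> are used up, so \<open>p a < n - 1 - a\<close>. Within a row larger
  second coordinates have smaller keys, which favours the antidiagonal.\<close>

lemma permutation_monomial_less:
  assumes p: "p permutes {0..<n}" and "k < n" "p k \<noteq> n - 1 - k"
  shows "lex_less antidiagonal_key (\<Sum>k=0..<n. single (i + k, j + p k) 1)
    (\<Sum>k=0..<n. single (i + k, j + (n - 1 - k)) 1)"
proof -
  define a where "a = (LEAST k. k < n \<and> p k \<noteq> n - 1 - k)"
  have a: "a < n" "p a \<noteq> n - 1 - a"
    using LeastI[of "\<lambda>k. k < n \<and> p k \<noteq> n - 1 - k" k] assms(2,3) by (auto simp: a_def)
  have before: "p k = n - 1 - k" if "k < a" for k
    using not_less_Least[of k "\<lambda>k. k < n \<and> p k \<noteq> n - 1 - k"] that a(1) by (auto simp: a_def)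
  have "p a < n - 1 - a"
  proof (rule ccontr)
    assume "\<not> ?thesis"
    then have gt: "n - 1 - a < p a" using a(2) by simp
    have "p a < n" using permutes_lt[OF p a(1)] .
    then have "p (n - 1 - p a) = p a" using before[of "n - 1 - p a"] gt by simp
    then have "n - 1 - p a = a" using permutes_inj[OF p] by (auto dest: injD)
    then show False using gt \<open>p a < n\<close> by linarith
  qed
  define m1 m2 where "m1 = (\<Sum>k=0..<n. single (i + k, j + p k) 1 :: monomial)"
    and "m2 = (\<Sum>k=0..<n. single (i + k, j + (n - 1 - k)) 1 :: monomial)"
  have m1: "lookup m1 (x, y) = (if i \<le> x \<and> x < i + n \<and> y = j + p (x - i) then 1 else 0)" for x y
    unfolding m1_def by (rule lookup_permutation_monomial)
  have m2: "lookup m2 (x, y) = (if i \<le> x \<and> x < i + n \<and> y = j + (n - 1 - (x - i)) then 1 else 0)" for x y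
    unfolding m2_def by (rule lookup_permutation_monomial)
  have "lex_less antidiagonal_key m1 m2"
    unfolding lex_less_def
  proof (intro exI[of _ "(i + a, j + (n - 1 - a))"] conjI allI impI)
    show "lookup m1 (i + a, j + (n - 1 - a)) < lookup m2 (i + a, j + (n - 1 - a))"
      using a(1) \<open>p a < n - 1 - a\<close> by (simp add: m1 m2)
    fix w assume w: "antidiagonal_key w < antidiagonal_key (i + a, j + (n - 1 - a))"
    obtain x y where xy: "w = (x, y)" by fastforce
    consider "x < i + a" | "x = i + a" "j + (n - 1 - a) < y"
      using w unfolding xy antidiagonal_key_def by force
    then show "lookup m1 w = lookup m2 w"
    proof cases
      case 1
      then have "p (x - i) = n - 1 - (x - i)" if "i \<le> x" using before[of "x - i"] that by simp
      then show ?thesis by (simp add: xy m1 m2)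
    next
      case 2
      then have "y \<noteq> j + p a" "y \<noteq> j + (n - 1 - a)" using \<open>p a < n - 1 - a\<close> by linarith+
      then show ?thesis using 2(1) by (simp add: xy m1 m2)
    qed
  qed
  then show ?thesis by (simp only: m1_def m2_def)
qed

text \<open>The antidiagonal monomial exceeds those of all other permutations, so its coefficient is
  a sign. Zero entries off the antidiagonal only delete smaller terms.\<close>

lemma antidiagonal_det_initial:
  fixes i j n :: nat and V :: "vertex set"
  defines "e \<equiv> \<lambda>a b. if (i + a, j + b) \<in> V then indet (i + a, j + b) else (0 :: 'k::field polynomial)"
  assumes V: "\<And>a. a < n \<Longrightarrow> (i + a, j + (n - 1 - a)) \<in> V"
  shows "initial_monomial (lex_order antidiagonal_key V) (Determinant.det (mat n n (\<lambda>(a, b). e a b)))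
    (\<Sum>k=0..<n. single (i + k, j + (n - 1 - k)) 1)"
proof -
  let ?mon = "\<lambda>p. \<Sum>k=0..<n. single (i + k, j + p k) 1 :: monomial"
  let ?P = "{p. p permutes {0..<n}}"
  let ?D = "Determinant.det (mat n n (\<lambda>(a, b). e a b))"
  define \<tau> where "\<tau> a = (if a < n then n - 1 - a else a)" for a
  have tau: "\<tau> permutes {0..<n}"
  proof (rule bij_imp_permutes)
    show "bij_betw \<tau> {0..<n} {0..<n}"
      by (rule bij_betwI[of _ _ _ \<tau>]) (auto simp: \<tau>_def)
  qed (auto simp: \<tau>_def)
  have mon_tau: "?mon \<tau> = (\<Sum>k=0..<n. single (i + k, j + (n - 1 - k)) 1)"
    by (intro sum.cong) (auto simp: \<tau>_def)
  have less: "lex_less antidiagonal_key (?mon p) (?mon \<tau>)" if "p \<in> ?P - {\<tau>}" for p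
  proof -
    have p: "p permutes {0..<n}" using that by simp
    have "\<exists>k<n. p k \<noteq> n - 1 - k"
    proof (rule ccontr)
      assume "\<not> ?thesis"
      then have "p k = \<tau> k" for k
        using permutes_not_in[OF p, of k] by (cases "k < n") (auto simp: \<tau>_def)
      then show False using that by auto
    qed
    then show ?thesis unfolding mon_tau using permutation_monomial_less[OF p] by blast
  qed
  have prod_e: "(\<Prod>k=0..<n. e k (p k)) = (if \<forall>k<n. (i + k, j + p k) \<in> V then single (?mon p) 1 else 0)" for p
  proof -
    have "(\<Prod>k\<in>A. indet (i + k, j + p k) :: 'k polynomial) = single (\<Sum>k\<in>A. single (i + k, j + p k) 1) 1" for A
      by (induction A rule: infinite_finite_induct) (simp_all add: indet_def mult_single)
    then show ?thesis
      by (auto simp: e_def intro!: prod_zero prod.cong trans[OF prod.cong])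
  qed
  have D: "?D = (\<Sum>p\<in>?P. signof p * (\<Prod>k=0..<n. e k (p k)))"
    unfolding det_def'[OF mat_carrier]
    by (intro sum.cong prod.cong arg_cong2[where f = "(*)"]) (auto simp: permutes_lt)
  have sg: "lookup (signof p * q) m = signof p * lookup q m" for p :: "nat \<Rightarrow> nat" and q :: "'k polynomial" and m
    by (simp add: sign_def)
  have "lookup ?D (?mon \<tau>) = (\<Sum>p\<in>?P. signof p * lookup (\<Prod>k=0..<n. e k (p k)) (?mon \<tau>))"
    unfolding D lookup_sum sg ..
  also have "\<dots> = (\<Sum>p\<in>?P. if p = \<tau> then signof \<tau> else 0)"
  proof (rule sum.cong[OF refl])
    fix p assume p: "p \<in> ?P"
    show "signof p * lookup (\<Prod>k=0..<n. e k (p k)) (?mon \<tau>) = (if p = \<tau> then signof \<tau> else 0)"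
    proof (cases "p = \<tau>")
      case True
      then show ?thesis using V by (simp add: prod_e \<tau>_def)
    next
      case False
      then have "?mon p \<noteq> ?mon \<tau>" using less[of p] p lex_less_irrefl by force
      then show ?thesis using False by (simp add: prod_e lookup_single)
    qed
  qed
  also have "\<dots> = signof \<tau>" using tau by (simp add: finite_permutations)
  finally have "?mon \<tau> \<in> keys ?D" by (simp add: in_keys_iff sign_def)
  moreover have "(m, ?mon \<tau>) \<in> lex_order antidiagonal_key V" if m: "m \<in> keys ?D" for m
  proof -
    have "\<exists>p\<in>?P. lookup (signof p * (\<Prod>k=0..<n. e k (p k))) m \<noteq> 0"
    proof (rule ccontr)
      assume "\<not> ?thesis"
      then have "lookup ?D m = 0" unfolding D lookup_sum by (intro sum.neutral) auto
      then show False using m by (simp add: in_keys_iff)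
    qed
    then obtain p where p: "p \<in> ?P" "lookup (\<Prod>k=0..<n. e k (p k)) m \<noteq> 0"
      unfolding sg by auto
    then have pV: "\<forall>k<n. (i + k, j + p k) \<in> V" and mp: "m = ?mon p"
      by (auto simp: prod_e lookup_single when_def split: if_splits)
    have mono: "?mon q \<in> monomials V" if "\<forall>k<n. (i + k, j + q k) \<in> V" for q
      using that keys_sum[of "\<lambda>k. single (i + k, j + q k) 1 :: monomial" "{0..<n}"]
      unfolding monomials_def by fastforce
    have "?mon \<tau> \<in> monomials V" using V by (intro mono) (auto simp: \<tau>_def)
    then show ?thesis
      using mono[OF pV] less[of p] p(1) by (auto simp: lex_order_def mp)
  qed
  ultimately show ?thesis unfolding mon_tau by (simp add: initial_monomial_def)
qed

section \<open>The determinants of the antidiagonal chains\<close>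

lemma chain_nth:
  assumes Vs: "antidiagonal_partition P Vs" "vs \<in> set Vs" and "l < length vs"
  shows "vs ! l = (fst (hd vs) + l, snd (last vs) + (length vs - 1 - l))"
proof -
  have "vs \<noteq> []" using assms(3) by auto
  have *: "fst (vs ! l) = fst (vs ! 0) + l \<and> snd (vs ! l) + l = snd (vs ! 0)" if "l < length vs" for l
    using that
  proof (induction l)
    case (Suc l)
    then obtain c where "vs ! l = upper_left c" "vs ! Suc l = lower_right c"
      using Vs unfolding antidiagonal_partition_def by blast
    then show ?case using Suc by (auto simp: upper_left_def lower_right_def)
  qed simp
  from *[of "length vs - 1"] *[OF assms(3)] \<open>vs \<noteq> []\<close> show ?thesis
    using assms(3) by (auto simp: prod_eq_iff hd_conv_nth last_conv_nth)
qed

lemma chain_det_eq: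
  "(chain_det P vs :: 'k::field polynomial) = Determinant.det (mat (length vs) (length vs)
    (\<lambda>(a, b). if (fst (hd vs) + a, snd (last vs) + b) \<in> vertices P
       then indet (fst (hd vs) + a, snd (last vs) + b) else 0))"
  by (simp add: chain_det_def chain_matrix_def Let_def)

lemma chain_det_in_poly_ring: "chain_det P vs \<in> carrier (poly_ring (vertices P))"
  unfolding chain_det_eq by (rule poly_ring_det) auto

lemma chain_vertices:
  assumes "antidiagonal_partition P Vs" "vs \<in> set Vs" shows "set vs \<subseteq> vertices P"
  using assms unfolding antidiagonal_partition_def by auto

lemma chain_det_initial:
  assumes Vs: "antidiagonal_partition P Vs" "vs \<in> set Vs"
  shows "initial_monomial (lex_order antidiagonal_key (vertices P))
    (chain_det P vs :: 'k::field polynomial) (\<Sum>v\<leftarrow>vs. single v 1)"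
proof -
  have "(\<Sum>v\<leftarrow>vs. single v 1 :: monomial) = (\<Sum>k=0..<length vs. single (vs ! k) 1)"
    by (simp add: sum_list_sum_nth)
  also have "\<dots> = (\<Sum>k=0..<length vs. single (fst (hd vs) + k, snd (last vs) + (length vs - 1 - k)) 1)"
    by (rule sum.cong) (simp_all add: chain_nth[OF Vs])
  finally have eq: "(\<Sum>v\<leftarrow>vs. single v 1 :: monomial) =
    (\<Sum>k=0..<length vs. single (fst (hd vs) + k, snd (last vs) + (length vs - 1 - k)) 1)" .
  show ?thesis
    unfolding chain_det_eq eq
  proof (rule antidiagonal_det_initial)
    fix a assume a: "a < length vs"
    show "(fst (hd vs) + a, snd (last vs) + (length vs - 1 - a)) \<in> vertices P"
      using nth_mem[OF a] chain_vertices[OF Vs] unfolding chain_nth[OF Vs a] by blast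
  qed
qed

lemma poly_ring_prod_list:
  "(\<And>a. a \<in> set L \<Longrightarrow> f a \<in> carrier (poly_ring V)) \<Longrightarrow> (\<Prod>a\<leftarrow>L. f a) \<in> carrier (poly_ring V)"
  by (induction L) auto

lemma chain_prod_initial:
  assumes Vs: "antidiagonal_partition P Vs" "set L \<subseteq> set Vs"
  shows "initial_monomial (lex_order antidiagonal_key (vertices P))
    (\<Prod>vs\<leftarrow>L. chain_det P vs :: 'k::field polynomial) (\<Sum>v\<leftarrow>concat L. single v 1)"
  using Vs(2)
proof (induction L)
  case Nil
  then show ?case by (simp add: initial_monomial_def lex_order_def monomials_def)
next
  case (Cons vs L)
  then have "initial_monomial (lex_order antidiagonal_key (vertices P))
    (chain_det P vs * (\<Prod>vs\<leftarrow>L. chain_det P vs :: 'k polynomial))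
    ((\<Sum>v\<leftarrow>vs. single v 1) + (\<Sum>v\<leftarrow>concat L. single v 1))"
    by (intro initial_monomial_mult[OF monomial_order_lex[OF inj_antidiagonal_key]]
        chain_det_initial[OF Vs(1)] poly_ring_prod_list chain_det_in_poly_ring) auto
  then show ?case by simp
qed

lemma squarefree_sum_list:
  assumes "distinct xs" shows "squarefree_monomial (\<Sum>v\<leftarrow>xs. single v 1)"
proof -
  have "lookup (\<Sum>v\<leftarrow>xs. single v 1) w = (if w \<in> set xs then 1 else 0 :: nat)" for w
    using assms by (induction xs) (auto simp: lookup_add lookup_single when_def)
  then show ?thesis by (simp add: squarefree_monomial_def)
qed

lemma distinct_concat_filter: "distinct (concat xss) \<Longrightarrow> distinct (concat (filter Q xss))"
  by (induction xss) auto

text \<open>The chains are disjoint, so the product of their antidiagonal monomials is square-free.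
  The filter covers both \<open>f\<close> and \<open>g\<close>.\<close>

lemma chain_prod_squarefree_initial:
  assumes Vs: "antidiagonal_partition P Vs"
  shows "has_squarefree_initial (vertices P) (\<Prod>vs\<leftarrow>filter Q Vs. chain_det P vs :: 'k::field polynomial)"
proof -
  have "initial_monomial (lex_order antidiagonal_key (vertices P))
    (\<Prod>vs\<leftarrow>filter Q Vs. chain_det P vs :: 'k polynomial) (\<Sum>v\<leftarrow>concat (filter Q Vs). single v 1)"
    by (rule chain_prod_initial[OF Vs]) auto
  moreover have "squarefree_monomial (\<Sum>v\<leftarrow>concat (filter Q Vs). single v 1)"
    using Vs by (intro squarefree_sum_list distinct_concat_filter) (simp add: antidiagonal_partition_def)
  ultimately show ?thesis
    unfolding has_squarefree_initial_def using monomial_order_lex[OF inj_antidiagonal_key] by blast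
qed

section \<open>Knutson ideals\<close>

lemma ideal_zero: "ideal {0} (poly_ring V)"
  by (rule ideal_poly_ringI) auto

lemma add_ideals_poly_ring:
  assumes I: "ideal I (poly_ring V)" and J: "ideal J (poly_ring V)"
  shows "I \<subseteq> I <+>\<^bsub>poly_ring V\<^esub> J" "J \<subseteq> I <+>\<^bsub>poly_ring V\<^esub> J"
    and "ideal T (poly_ring V) \<Longrightarrow> I \<subseteq> T \<Longrightarrow> J \<subseteq> T \<Longrightarrow> I <+>\<^bsub>poly_ring V\<^esub> J \<subseteq> T"
proof -
  have eq: "I <+>\<^bsub>poly_ring V\<^esub> J = {x + y | x y. x \<in> I \<and> y \<in> J}"
    by (auto simp: set_add_def')
  show "I \<subseteq> I <+>\<^bsub>poly_ring V\<^esub> J" "J \<subseteq> I <+>\<^bsub>poly_ring V\<^esub> J"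
    unfolding eq using ideal_poly_ringD(2)[OF I] ideal_poly_ringD(2)[OF J] by force+
  show "I <+>\<^bsub>poly_ring V\<^esub> J \<subseteq> T" if "ideal T (poly_ring V)" "I \<subseteq> T" "J \<subseteq> T"
    unfolding eq using that(2,3) ideal_poly_ringD(3)[OF that(1)] by blast
qed

lemma ideal_colon:
  assumes I: "ideal I (poly_ring V)" and J: "J \<subseteq> carrier (poly_ring V)"
  shows "ideal (colon (poly_ring V) I J) (poly_ring V)"
proof (rule ideal_poly_ringI)
  fix x y :: "'a polynomial"
  assume "x \<in> carrier (poly_ring V)" "y \<in> colon (poly_ring V) I J"
  then show "x * y \<in> colon (poly_ring V) I J"
    using ideal_poly_ringD(4)[OF I] by (auto simp: colon_def mult.assoc)
qed (use ideal_poly_ringD(2,3)[OF I] in \<open>auto simp: colon_def distrib_right\<close>)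

text \<open>For fixed \<open>x\<close>, the elements \<open>y\<close> with \<open>x y\<close> in
  \<open>I\<close> form an ideal, so testing the generator \<open>h\<close> suffices.\<close>

lemma colon_principal:
  assumes I: "ideal I (poly_ring V)" and h: "h \<in> carrier (poly_ring V)"
  shows "colon (poly_ring V) I (Idl\<^bsub>poly_ring V\<^esub> {h}) = {x \<in> carrier (poly_ring V). x * h \<in> I}"
proof -
  interpret ring "poly_ring V :: 'a polynomial ring" by (rule ring_poly_ring)
  have "x * y \<in> I" if x: "x \<in> carrier (poly_ring V)" "x * h \<in> I" and y: "y \<in> Idl\<^bsub>poly_ring V\<^esub> {h}" for x y
  proof -
    have "ideal {y \<in> carrier (poly_ring V). x * y \<in> I} (poly_ring V)"
    proof (rule ideal_poly_ringI)
      fix z y :: "'a polynomial"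
      assume z: "z \<in> carrier (poly_ring V)" and y: "y \<in> {y \<in> carrier (poly_ring V). x * y \<in> I}"
      then have "z * (x * y) \<in> I" using ideal_poly_ringD(4)[OF I] by blast
      then show "z * y \<in> {y \<in> carrier (poly_ring V). x * y \<in> I}"
        using z y by (simp add: mult.left_commute)
    qed (use ideal_poly_ringD(2,3)[OF I] in \<open>auto simp: distrib_left\<close>)
    then have "Idl\<^bsub>poly_ring V\<^esub> {h} \<subseteq> {y \<in> carrier (poly_ring V). x * y \<in> I}"
      using x h by (intro genideal_minimal) auto
    then show ?thesis using y by blast
  qed
  then show ?thesis using genideal_self'[OF h] by (auto simp: colon_def)
qed

lemma principal_ideal_poly_ring:
  assumes "f \<in> carrier (poly_ring V)"
  shows "Idl\<^bsub>poly_ring V\<^esub> {f} = {s * f | s. s \<in> carrier (poly_ring V)}"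
  using cring.cgenideal_eq_genideal[OF cring_poly_ring assms] by (simp add: cgenideal_def)

lemma ideal_principal: "f \<in> carrier (poly_ring V) \<Longrightarrow> ideal (Idl\<^bsub>poly_ring V\<^esub> {f}) (poly_ring V)"
  using ring.genideal_ideal[OF ring_poly_ring] by force

lemma ideal_knutson:
  assumes "I \<in> knutson_ideals V f" shows "ideal I (poly_ring V)"
  using assms
proof induction
  case (colon I J)
  then show ?case using ideal_colon ideal_poly_ringD(1) by blast
next
  case (sum I J)
  then show ?case using ring.add_ideals[OF ring_poly_ring] by blast
next
  case (inter I J)
  then show ?case using ring.i_intersect[OF ring_poly_ring] by blast
qed (rule ideal_principal)

lemma knutson_colon_principal:
  assumes "I \<in> knutson_ideals V f" "h \<in> carrier (poly_ring V)"
  shows "{x \<in> carrier (poly_ring V). x * h \<in> I} \<in> knutson_ideals V f"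
  using knutson_ideals.colon[OF assms(1) ideal_principal[OF assms(2)]]
    colon_principal[OF ideal_knutson[OF assms(1)] assms(2)] by simp

text \<open>In a domain \<open>(p q) : (q) = (p)\<close> for nonzero \<open>q\<close>.\<close>

lemma knutson_factor:
  assumes "Idl\<^bsub>poly_ring V\<^esub> {p * q} \<in> knutson_ideals V f" "q \<noteq> 0"
    "p \<in> carrier (poly_ring V)" "q \<in> carrier (poly_ring V)"
  shows "Idl\<^bsub>poly_ring V\<^esub> {p} \<in> knutson_ideals V f"
proof -
  have "{x \<in> carrier (poly_ring V). x * q \<in> Idl\<^bsub>poly_ring V\<^esub> {p * q}} = Idl\<^bsub>poly_ring V\<^esub> {p}"
    using assms(2-) by (auto simp: principal_ideal_poly_ring mult.assoc[symmetric])
  then show ?thesis using knutson_colon_principal[OF assms(1,4)] by simp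
qed

text \<open>The zero ideal is admitted because it starts the induction over the antidiagonals.\<close>
lemma knutson_join:
  assumes L: "L = {0} \<or> L \<in> knutson_ideals V f" and M: "M \<in> knutson_ideals V f"
  shows "\<exists>N\<in>knutson_ideals V f. L \<subseteq> N \<and> M \<subseteq> N \<and>
    (\<forall>T. ideal T (poly_ring V) \<longrightarrow> L \<subseteq> T \<longrightarrow> M \<subseteq> T \<longrightarrow> N \<subseteq> T)"
  using L
proof
  assume "L = {0}"
  then show ?thesis using M ideal_poly_ringD(2)[OF ideal_knutson[OF M]] by auto
next
  assume L: "L \<in> knutson_ideals V f"
  show ?thesis
    using knutson_ideals.sum[OF L M] add_ideals_poly_ring[OF ideal_knutson[OF L] ideal_knutson[OF M]]
    by blast
qed

lemma saturated_power_iff: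
  assumes "saturated V T" "p \<in> carrier (poly_ring V)"
  shows "(\<Prod>v\<in>V. indet v) ^ n * p \<in> T \<longleftrightarrow> p \<in> T"
proof (induction n)
  case (Suc n)
  have "(\<Prod>v\<in>V. indet v) * ((\<Prod>v\<in>V. indet v) ^ n * p) \<in> T \<longleftrightarrow> (\<Prod>v\<in>V. indet v) ^ n * p \<in> T"
    using assms(2) by (intro saturated_prod_iff[OF assms(1)] poly_ring_mult poly_ring_power poly_ring_prod) auto
  then show ?case using Suc by (simp add: mult.assoc)
qed simp

lemma saturation_least: "saturated V T \<Longrightarrow> L \<subseteq> T \<Longrightarrow> saturation V L \<subseteq> T"
  unfolding saturation_def using saturated_power_iff by blast

lemma cell_minor_in_poly_ring:
  assumes "c \<in> P" shows "cell_minor c \<in> carrier (poly_ring (vertices P))"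
  using assms vertices_of_cell[of "fst c" "snd c" P]
  by (intro poly_ring_minor) (auto simp: upper_right_def)

section \<open>The cells along the chains\<close>

abbreviation level :: "vertex \<Rightarrow> nat" where
  "level c \<equiv> fst c + snd c"

locale corner_closed_chains =
  fixes P :: cells and Vs :: "vertex list list"
  assumes fin: "finite P" and closed: "corner_closed P" and Vs: "antidiagonal_partition P Vs"
begin

abbreviation V :: "vertex set" where "V \<equiv> vertices P"

text \<open>For \<open>1 <= a < length vs\<close> this is the cell between the chain vertices
  \<open>vs ! (a - 1)\<close> and \<open>vs ! a\<close>, written in the coordinates of the
  matrix.\<close>

definition chain_cell :: "vertex list \<Rightarrow> nat \<Rightarrow> vertex" where
  "chain_cell vs a = (fst (hd vs) + (a - 1), snd (last vs) + (length vs - a - 1))"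

lemma chain_cell_eq:
  assumes "vs \<in> set Vs" "a \<in> {1..<length vs}"
  shows "chain_cell vs a \<in> P" "vs ! (a - 1) = upper_left (chain_cell vs a)"
    and "vs ! a = lower_right (chain_cell vs a)"
proof -
  have "\<exists>c\<in>P. vs ! (a - 1) = upper_left c \<and> vs ! Suc (a - 1) = lower_right c"
    using Vs assms(1) assms(2) unfolding antidiagonal_partition_def
    by (elim conjE ballE[of _ _ vs] allE[of _ "a - 1"]) auto
  then obtain c where c: "c \<in> P" "vs ! (a - 1) = upper_left c" "vs ! a = lower_right c"
    using assms(2) by auto
  have "c = chain_cell vs a"
    using c(2,3) chain_nth[OF Vs assms(1), of a] chain_nth[OF Vs assms(1), of "a - 1"] assms(2)
    by (cases c) (auto simp: upper_left_def lower_right_def chain_cell_def)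
  then show "chain_cell vs a \<in> P" "vs ! (a - 1) = upper_left (chain_cell vs a)"
    "vs ! a = lower_right (chain_cell vs a)" using c by auto
qed

text \<open>Starting from the cells of the chain, corner closedness propagates to the lower
  left.\<close>

lemma chain_triangle:
  assumes vs: "vs \<in> set Vs" and "a + b + 2 \<le> length vs"
  shows "(fst (hd vs) + a, snd (last vs) + b) \<in> P"
  using assms(2)
proof (induction "length vs - (a + b)" arbitrary: a b rule: less_induct)
  case less
  show ?case
  proof (cases "a + b + 2 = length vs")
    case True
    then have "length vs - Suc (Suc a) = b" by simp
    then show ?thesis using chain_cell_eq(1)[OF vs, of "Suc a"] True by (simp add: chain_cell_def)
  next
    case False
    then have "(fst (hd vs) + a, snd (last vs) + Suc b) \<in> P" "(fst (hd vs) + Suc a, snd (last vs) + b) \<in> P"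
      using less.hyps[of a "Suc b"] less.hyps[of "Suc a" b] less.prems by auto
    then show ?thesis using corner_closedD[OF closed] by simp
  qed
qed

lemma chain_triangle_vertices:
  assumes vs: "vs \<in> set Vs" and "2 \<le> length vs" "a < length vs" "b < length vs" "a + b \<le> length vs"
  shows "(fst (hd vs) + a, snd (last vs) + b) \<in> V"
proof -
  \<comment> \<open>The bound \<open>a + b <= length vs\<close> includes the upper-right vertices of
    the chain cells. For \<open>a = 0\<close> or \<open>b = 0\<close> truncated subtraction selects
    a cell with the vertex on its left or lower side.\<close>
  define x y where "x = fst (hd vs) + (a - 1)" and "y = snd (last vs) + (b - 1)"
  have "(x, y) \<in> P" unfolding x_def y_def using assms by (intro chain_triangle) auto
  from vertices_of_cell[OF this] show ?thesis
    by (cases a; cases b) (simp_all add: x_def y_def)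
qed

lemma chain_det_in_saturated_iff:
  assumes vs: "vs \<in> set Vs" "2 \<le> length vs" and J: "saturated V J" and "a \<in> {1..<length vs}"
    and lower: "\<And>c. c \<in> P \<Longrightarrow> level c < level (chain_cell vs a) \<Longrightarrow> (cell_minor c :: 'k::field polynomial) \<in> J"
  shows "chain_det P vs \<in> J \<longleftrightarrow> (\<Prod>a=1..<length vs. cell_minor (chain_cell vs a)) \<in> J"
  unfolding chain_det_eq chain_cell_def
proof (rule antidiagonal_det_in_saturated_iff[OF J])
  fix a' b' assume ab: "a' + b' + 2 < length vs"
  show "cell_minor (fst (hd vs) + a', snd (last vs) + b') \<in> J"
    using ab assms(4) by (intro lower chain_triangle[OF vs(1)]) (auto simp: chain_cell_def)
qed (use vs chain_triangle_vertices in auto)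

text \<open>The upper-left vertex of \<open>c\<close> lies on a chain but is not its last vertex;
  the step to the next vertex crosses \<open>c\<close>.\<close>

lemma exists_chain:
  assumes c: "c \<in> P"
  shows "\<exists>vs\<in>set Vs. 2 \<le> length vs \<and> (\<exists>a\<in>{1..<length vs}. chain_cell vs a = c)"
proof -
  have "upper_left c \<in> V"
    using vertices_of_cell(3)[of "fst c" "snd c" P] c by (simp add: upper_left_def)
  then have "upper_left c \<in> set (concat Vs)" using Vs by (simp add: antidiagonal_partition_def)
  then obtain vs i where vs: "vs \<in> set Vs" "i < length vs" "vs ! i = upper_left c"
    by (auto simp: in_set_conv_nth)
  have "last vs \<noteq> upper_left c" using Vs vs(1) c by (auto simp: antidiagonal_partition_def)
  then have i: "Suc i < length vs"
    using vs by (metis Suc_lessI diff_Suc_1 last_conv_nth length_0_conv not_less_zero)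
  then have "upper_left (chain_cell vs (Suc i)) = upper_left c"
    using chain_cell_eq(2)[OF vs(1), of "Suc i"] vs(3) by simp
  then have "chain_cell vs (Suc i) = c" by (simp add: upper_left_def prod_eq_iff)
  then show ?thesis using vs(1) i by (intro bexI[of _ vs]) force+
qed

lemma chain_cell_inj:
  assumes "a \<in> {1..<length vs}" "a' \<in> {1..<length vs}" "chain_cell vs a = chain_cell vs a'"
  shows "a = a'"
  using assms by (auto simp: chain_cell_def)

lemma level_chain_cell:
  assumes "a \<in> {1..<length vs}" "a' \<in> {1..<length vs}"
  shows "level (chain_cell vs a) = level (chain_cell vs a')"
  using assms by (auto simp: chain_cell_def)

end

text \<open>\<open>Q\<close> selects the factors, so that \<open>f\<close> and \<open>g\<close> are
  treated together; every chain that carries a cell is selected.\<close>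

locale knutson_chains = corner_closed_chains +
  fixes Q :: "vertex list \<Rightarrow> bool" and f :: "'k::field polynomial"
  assumes Q: "\<And>vs. 2 \<le> length vs \<Longrightarrow> Q vs"
    and f: "f = (\<Prod>vs\<leftarrow>filter Q Vs. chain_det P vs)"
begin

text \<open>A colon by the product of the other factors of \<open>f\<close> isolates the
  determinant.\<close>

lemma principal_chain_det:
  assumes vs: "vs \<in> set Vs" "2 \<le> length vs"
  shows "Idl\<^bsub>poly_ring V\<^esub> {chain_det P vs} \<in> knutson_ideals V f"
proof (rule knutson_factor)
  let ?rest = "\<Prod>ws\<leftarrow>remove1 vs (filter Q Vs). chain_det P ws :: 'k polynomial"
  have "(\<Prod>ws\<leftarrow>L. chain_det P ws) = chain_det P vs * (\<Prod>ws\<leftarrow>remove1 vs L. chain_det P ws :: 'k polynomial)"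
    if "vs \<in> set L" for L
    using that by (induction L) (auto simp: mult.left_commute)
  then have eq: "f = chain_det P vs * ?rest" unfolding f using vs Q by auto
  have "f \<in> carrier (poly_ring V)" unfolding f
    by (intro poly_ring_prod_list chain_det_in_poly_ring)
  moreover have sq: "has_squarefree_initial V f" unfolding f by (rule chain_prod_squarefree_initial[OF Vs])
  ultimately show "Idl\<^bsub>poly_ring V\<^esub> {chain_det P vs * ?rest} \<in> knutson_ideals V f"
    using knutson_ideals.principal[of f V] eq by simp
  have "f \<noteq> 0" using sq by (auto simp: has_squarefree_initial_def initial_monomial_def)
  then show "?rest \<noteq> 0" using eq by auto
qed (auto intro: poly_ring_prod_list chain_det_in_poly_ring)

lemma adjoin_cell:
  assumes L: "ideal L (poly_ring V)" "L = {0} \<or> L \<in> knutson_ideals V f"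
    and toric: "L \<subseteq> toric_ideal V {c \<in> P. level c < s}"
    and minors: "\<forall>c\<in>P. level c < s \<longrightarrow> cell_minor c \<in> saturation V L"
    and c: "c \<in> P" "level c = s"
  shows "\<exists>M\<in>knutson_ideals V f. L \<subseteq> M \<and> M \<subseteq> toric_ideal V (insert c {c \<in> P. level c < s}) \<and> cell_minor c \<in> M"
proof -
  let ?D = "insert c {c \<in> P. level c < s}"
  let ?w = "\<Prod>v\<in>V. indet v :: 'k polynomial"
  have finV: "finite V" by (rule finite_vertices[OF fin])
  have w: "?w ^ n \<in> carrier (poly_ring V)" for n by auto
  obtain vs a where vs: "vs \<in> set Vs" "2 \<le> length vs" and a: "a \<in> {1..<length vs}" "chain_cell vs a = c"
    using exists_chain[OF c(1)] by blast
  let ?m = "\<lambda>a. cell_minor (chain_cell vs a) :: 'k polynomial"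
  let ?A = "{1..<length vs} - {a}"
  have m: "?m a' \<in> carrier (poly_ring V)" if "a' \<in> {1..<length vs}" for a'
    by (rule cell_minor_in_poly_ring[OF chain_cell_eq(1)[OF vs(1) that]])
  have rest: "prod ?m ?A \<in> carrier (poly_ring V)" using m by (intro poly_ring_prod) auto
  have split: "prod ?m {1..<length vs} = ?m a * prod ?m ?A" using a by (intro prod.remove) auto
  obtain L1 where L1: "L1 \<in> knutson_ideals V f" "L \<subseteq> L1" "Idl\<^bsub>poly_ring V\<^esub> {chain_det P vs} \<subseteq> L1"
    and least: "\<And>T. ideal T (poly_ring V) \<Longrightarrow> L \<subseteq> T \<Longrightarrow> Idl\<^bsub>poly_ring V\<^esub> {chain_det P vs} \<subseteq> T \<Longrightarrow> L1 \<subseteq> T"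
    using knutson_join[OF L(2) principal_chain_det[OF vs]] by blast
  note I1 = ideal_knutson[OF L1(1)]
  have "chain_det P vs \<in> L1"
    using L1(3) ring.genideal_self'[OF ring_poly_ring chain_det_in_poly_ring] by blast
  then have "chain_det P vs \<in> saturation V L1" using saturation_superset[OF I1] by blast
  moreover have "cell_minor c' \<in> saturation V L1" if "c' \<in> P" "level c' < level (chain_cell vs a)" for c'
    using bspec[OF minors that(1)] saturation_mono[OF L1(2)] that(2) unfolding a(2) c(2) by blast
  ultimately have "prod ?m {1..<length vs} \<in> saturation V L1"
    using chain_det_in_saturated_iff[OF vs saturated_saturation[OF I1 finV] a(1)] by blast
  then obtain n where n: "?w ^ n * prod ?m {1..<length vs} \<in> L1" by (auto simp: saturation_def)
  define h where "h = ?w ^ n * prod ?m ?A"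
  have h: "h \<in> carrier (poly_ring V)" unfolding h_def using w rest by simp
  define M where "M = {x \<in> carrier (poly_ring V). x * h \<in> L1}"
  have "M \<in> knutson_ideals V f" unfolding M_def by (rule knutson_colon_principal[OF L1(1) h])
  moreover have "L \<subseteq> M"
    using L1(2) ideal_poly_ringD(1)[OF L(1)] ideal_poly_ringD(5)[OF I1 _ h] by (auto simp: M_def)
  moreover have "cell_minor c \<in> M"
    using n m[OF a(1)] unfolding M_def h_def split by (simp add: a(2) mult_ac)
  moreover have "M \<subseteq> toric_ideal V ?D"
  proof
    fix x assume x: "x \<in> M"
    let ?T = "toric_ideal V ?D :: 'k polynomial set"
    have sub: "cell c' \<subseteq> V" if "c' \<in> P" for c' using that by (auto simp: vertices_def)
    have cT: "cell_minor c' \<in> ?T" if "c' \<in> ?D" for c'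
      using cell_minor_in_toric_ideal[OF that, of V] sub[of c'] that c(1) by blast
    \<comment> \<open>As \<open>c\<close> now belongs to the set of cells, its minor puts the whole
      product, and hence the determinant, into \<open>?T\<close>.\<close>
    have "?m a * prod ?m ?A \<in> ?T"
      using ideal_poly_ringD(5)[OF ideal_toric_ideal cT[of c] rest] a(2) by simp
    moreover have "chain_det P vs \<in> ?T \<longleftrightarrow> prod ?m {1..<length vs} \<in> ?T"
    proof (rule chain_det_in_saturated_iff[OF vs saturated_toric_ideal a(1)])
      fix c' assume "c' \<in> P" "level c' < level (chain_cell vs a)"
      then show "cell_minor c' \<in> ?T" using cT[of c'] c a by auto
    qed
    ultimately have "chain_det P vs \<in> ?T" by (simp only: split)
    then have "Idl\<^bsub>poly_ring V\<^esub> {chain_det P vs} \<subseteq> ?T"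
      by (intro ring.genideal_minimal[OF ring_poly_ring ideal_toric_ideal]) simp
    moreover have "L \<subseteq> ?T" using toric toric_ideal_mono[of "{c \<in> P. level c < s}" ?D V] by blast
    ultimately have "L1 \<subseteq> ?T" by (intro least ideal_toric_ideal)
    then have "x * h \<in> ?T" using x by (auto simp: M_def)
    then have "?w ^ n * (prod ?m ?A * x) \<in> ?T" by (simp add: h_def mult_ac)
    moreover have "prod ?m ?A * x \<in> carrier (poly_ring V)"
      using x by (intro poly_ring_mult rest) (simp add: M_def)
    ultimately have "prod ?m ?A * x \<in> ?T"
      using saturated_power_iff[OF saturated_toric_ideal] by blast
    then have "x * prod ?m ?A \<in> ?T" by (subst mult.commute)
    \<comment> \<open>The other chain cells have level \<open>s\<close> and differ from
      \<open>c\<close>, so \<open>?T\<close> contains none of their minors; primality then cancels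
      the product.\<close>
    moreover have "prod ?m ?A \<notin> ?T"
    proof (rule prod_notin_toric_ideal)
      fix a' assume a': "a' \<in> ?A"
      then have a'': "a' \<in> {1..<length vs}" "a' \<noteq> a" by auto
      then have "chain_cell vs a' \<noteq> c" using chain_cell_inj[OF a(1) a''(1)] a(2) by blast
      moreover have "level (chain_cell vs a') = s"
        using level_chain_cell[OF a(1) a''(1)] unfolding a(2) c(2) by (rule sym)
      ultimately have "chain_cell vs a' \<notin> ?D" by simp
      then show "?m a' \<notin> ?T" by (rule cell_minor_notin_toric_ideal)
    qed (use m in auto)
    moreover have "x \<in> carrier (poly_ring V)" using x by (simp add: M_def)
    ultimately show "x \<in> ?T" using toric_ideal_prime[OF _ _ _ rest] by blast
  qed
  ultimately show ?thesis by (intro bexI[of _ M] conjI)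
qed

text \<open>Every cell of the level is adjoined to the original \<open>L\<close>, not to the ideal
  obtained so far, because the colon step needs the other cells of the chain outside the toric
  bound. The results are added up.\<close>

lemma adjoin_cells:
  assumes L: "ideal L (poly_ring V)" "L = {0} \<or> L \<in> knutson_ideals V f"
    and toric: "L \<subseteq> toric_ideal V {c \<in> P. level c < s}"
    and minors: "\<forall>c\<in>P. level c < s \<longrightarrow> cell_minor c \<in> saturation V L"
    and "finite C" "C \<subseteq> {c \<in> P. level c = s}"
  shows "\<exists>M. (M = {0} \<or> M \<in> knutson_ideals V f) \<and> L \<subseteq> M \<and>
    M \<subseteq> toric_ideal V (C \<union> {c \<in> P. level c < s}) \<and> (\<forall>c\<in>C. cell_minor c \<in> M)"
  using assms(5,6)
proof (induction C)
  case empty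
  show ?case using L(2) toric by (intro exI[of _ L]) simp
next
  case (insert c C)
  have c: "c \<in> P" "level c = s" and "C \<subseteq> {c \<in> P. level c = s}" using insert.prems by auto
  from insert.IH[OF this(3)] obtain M where M: "M = {0} \<or> M \<in> knutson_ideals V f" "L \<subseteq> M"
    "M \<subseteq> toric_ideal V (C \<union> {c \<in> P. level c < s})" "\<forall>c\<in>C. cell_minor c \<in> M"
    by (elim exE conjE)
  from adjoin_cell[OF L toric minors c] obtain N where N: "N \<in> knutson_ideals V f" "L \<subseteq> N"
    "N \<subseteq> toric_ideal V (insert c {c \<in> P. level c < s})" "cell_minor c \<in> N"
    by (elim bexE conjE)
  let ?D = "insert c C \<union> {c \<in> P. level c < s}"
  obtain N' where N': "N' \<in> knutson_ideals V f" "M \<subseteq> N'" "N \<subseteq> N'"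
    "\<And>T. ideal T (poly_ring V) \<Longrightarrow> M \<subseteq> T \<Longrightarrow> N \<subseteq> T \<Longrightarrow> N' \<subseteq> T"
    using knutson_join[OF M(1) N(1)] by blast
  have "N' \<subseteq> toric_ideal V ?D"
  proof (rule N'(4)[OF ideal_toric_ideal])
    show "M \<subseteq> toric_ideal V ?D"
      using M(3) toric_ideal_mono[of "C \<union> {c \<in> P. level c < s}" ?D V] by blast
    show "N \<subseteq> toric_ideal V ?D"
      using N(3) toric_ideal_mono[of "insert c {c \<in> P. level c < s}" ?D V] by blast
  qed
  moreover have "L \<subseteq> N'" using N'(2) M(2) by simp
  moreover have "\<forall>c\<in>insert c C. cell_minor c \<in> N'" using N'(2,3) M(4) N(4) by blast
  ultimately show ?case using N'(1) by (intro exI[of _ N']) simp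
qed

lemma level_induction:
  "\<exists>L. ideal L (poly_ring V) \<and> (L = {0} \<or> L \<in> knutson_ideals V f) \<and>
    L \<subseteq> toric_ideal V {c \<in> P. level c < s} \<and>
    (\<forall>c\<in>P. level c < s \<longrightarrow> cell_minor c \<in> saturation V L)"
proof (induction s)
  case 0
  show ?case
    using ideal_zero ideal_poly_ringD(2)[OF ideal_toric_ideal] by (intro exI[of _ "{0}"]) auto
next
  case (Suc s)
  then obtain L where L: "ideal L (poly_ring V)" "L = {0} \<or> L \<in> knutson_ideals V f"
    "L \<subseteq> toric_ideal V {c \<in> P. level c < s}"
    "\<forall>c\<in>P. level c < s \<longrightarrow> cell_minor c \<in> saturation V L" by blast
  let ?C = "{c \<in> P. level c = s}"
  obtain M where M: "M = {0} \<or> M \<in> knutson_ideals V f" "L \<subseteq> M"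
    "M \<subseteq> toric_ideal V (?C \<union> {c \<in> P. level c < s})" "\<forall>c\<in>?C. cell_minor c \<in> M"
    using adjoin_cells[OF L, of ?C] fin by auto
  have IM: "ideal M (poly_ring V)" using M(1) ideal_zero ideal_knutson by blast
  have "?C \<union> {c \<in> P. level c < s} = {c \<in> P. level c < Suc s}" by auto
  moreover have "cell_minor c \<in> saturation V M" if "c \<in> P" "level c < Suc s" for c
  proof (cases "level c = s")
    case True
    then show ?thesis using M(4) that(1) saturation_superset[OF IM] by blast
  next
    case False
    then have "level c < s" using that(2) by simp
    then show ?thesis using bspec[OF L(4) that(1)] saturation_mono[OF M(2)] by blast
  qed
  ultimately show ?case using M IM by (intro exI[of _ M]) simp
qed

theorem polyomino_ideal_knutson:
  assumes "P \<noteq> {}"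
  shows "polyomino_ideal P \<in> knutson_ideals V f"
proof -
  let ?w = "\<Prod>v\<in>V. indet v :: 'k polynomial"
  define G :: "'k polynomial set" where "G = {minor a b | a b. inner_interval P a b}"
  have finV: "finite V" by (rule finite_vertices[OF fin])
  define s where "s = Suc (Max (level ` P))"
  have s: "level c < s" if "c \<in> P" for c
    unfolding s_def using that fin by (simp add: less_Suc_eq_le)
  then have D: "{c \<in> P. level c < s} = P" by blast
  obtain L where L: "ideal L (poly_ring V)" "L = {0} \<or> L \<in> knutson_ideals V f"
    "L \<subseteq> toric_ideal V P" "\<And>c. c \<in> P \<Longrightarrow> cell_minor c \<in> saturation V L"
    using level_induction[of s] s unfolding D by blast
  \<comment> \<open>Otherwise the minor of a cell would lie in the toric ideal of the empty set of
    cells.\<close>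
  have "L \<noteq> {0}"
  proof
    assume "L = {0}"
    then have "L \<subseteq> toric_ideal V {}" using ideal_poly_ringD(2)[OF ideal_toric_ideal] by simp
    then have "saturation V L \<subseteq> toric_ideal V {}" by (rule saturation_least[OF saturated_toric_ideal])
    then show False using assms L(4) cell_minor_notin_toric_ideal by blast
  qed
  then have K: "L \<in> knutson_ideals V f" using L(2) by simp
  \<comment> \<open>Finitely many generators admit a common exponent \<open>n\<close>, so one colon
    removes all monomial factors.\<close>
  have "finite G"
    by (rule finite_subset[of _ "(\<lambda>(a, b). minor a b) ` (V \<times> V)"])
      (use finV in \<open>auto simp: G_def inner_interval_def\<close>)
  moreover have GS: "G \<subseteq> saturation V L"
    unfolding G_def
  proof clarify
    fix i j k l assume ij: "inner_interval P (i, j) (k, l)"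
    note D = inner_intervalD[OF ij]
    show "minor (i, j) (k, l) \<in> saturation V L"
      using interval_vertices[OF D] L(4) D(3)
      by (intro minor_in_saturated[OF saturated_saturation[OF L(1) finV] D(1,2)]) auto
  qed
  ultimately obtain n where n: "\<forall>p\<in>G. ?w ^ n * p \<in> L"
    using saturation_uniform_exponent[OF L(1)] by blast
  define M where "M = {x \<in> carrier (poly_ring V). x * ?w ^ n \<in> L}"
  have M: "M \<in> knutson_ideals V f" unfolding M_def
    by (rule knutson_colon_principal[OF K]) auto
  have "G \<subseteq> M"
  proof
    fix p assume p: "p \<in> G"
    then have "p \<in> carrier (poly_ring V)" using GS by (auto simp: saturation_def)
    then show "p \<in> M" using bspec[OF n p] by (simp add: M_def mult.commute)
  qed
  then have "polyomino_ideal P \<subseteq> M"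
    unfolding polyomino_ideal_eq G_def
    by (rule ring.genideal_minimal[OF ring_poly_ring ideal_knutson[OF M]])
  moreover have "M \<subseteq> toric_ideal V P"
  proof
    fix x assume x: "x \<in> M"
    then have "?w ^ n * x \<in> toric_ideal V P" using L(3) by (auto simp: M_def mult.commute)
    then show "x \<in> toric_ideal V P"
      using saturated_power_iff[OF saturated_toric_ideal] x by (auto simp: M_def)
  qed
  \<comment> \<open>\<open>M\<close> is squeezed between the polyomino ideal and the toric ideal of
    \<open>P\<close>, which agree.\<close>
  ultimately have "polyomino_ideal P = M" unfolding toric_ideal_eq[OF fin closed] by (rule subset_antisym)
  then show ?thesis using M by simp
qed

end

theorem proposition4p10:
  fixes P Q :: cells and R :: "nat \<Rightarrow> cells" and r :: nat
    and Vs :: "vertex list list" and f g :: "'k::field polynomial"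
  assumes "polyomino P"
    and "P = Q \<union> (\<Union>i\<in>{1..r}. R i)"
    and "parallelogram_polyomino Q"
    and "\<And>i. i \<in> {1..r} \<Longrightarrow> sub_polyomino (R i) P \<and> ladder_polyomino (R i)"
    and "\<And>i. i \<in> {1..r} \<Longrightarrow> based_on (R i) Q"
    and "\<And>i j. i \<in> {1..r} \<Longrightarrow> j \<in> {1..r} \<Longrightarrow> i \<noteq> j \<Longrightarrow> vertices (R i) \<inter> vertices (R j) = {}"
    and "antidiagonal_partition P Vs"
    and "f = (\<Prod>vs\<leftarrow>Vs. chain_det P vs)"
    and "g = (\<Prod>vs\<leftarrow>filter (\<lambda>vs. 2 \<le> length vs) Vs. chain_det P vs)"
  shows "(polyomino_ideal P :: 'k polynomial set) \<in> knutson_ideals (vertices P) f \<and>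
         (polyomino_ideal P :: 'k polynomial set) \<in> knutson_ideals (vertices P) g"
proof -
  have "finite P" "P \<noteq> {}" using assms(1) by (auto simp: polyomino_def)
  moreover have "corner_closed P"
    using assms(4) by (intro parallelogram_ladders_corner_closed[OF assms(3,2) _ assms(5,6)]) auto
  ultimately interpret corner_closed_chains P Vs
    using assms(7) by unfold_locales
  interpret f: knutson_chains P Vs "\<lambda>_. True" f
    using assms(8) by unfold_locales auto
  interpret g: knutson_chains P Vs "\<lambda>vs. 2 \<le> length vs" g
    using assms(9) by unfold_locales auto
  show ?thesis
    using f.polyomino_ideal_knutson g.polyomino_ideal_knutson \<open>P \<noteq> {}\<close> by blast
qed

end
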